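(* Let $G$ be an $X$-generated group. Then $\xi_G=\theta_G^\sharp$, and thus $M_{sF}(G,X)=M(G,X)/\xi_G$ is presented, as an $X$-generated inverse monoid, by the relations: (i) $w^2=w$ for all words $w\in\overline X^*$ such that $w=1$ holds in $G$; (ii) $u=v^{-1}$ for all words $u,v\in\overline X^*$ such that $(u,v)\in\theta_G$.
   Context: Words: $\overline X=X\cup X^{-1}$ is the doubled alphabet; for a word $v\in\overline X^*$, $v^{-1}$ is the formal inverse word. A group or inverse monoid $S$ is $X$-generated if it comes with a (not necessarily injective) map $X\to S$ whose image generates it; $[w]_S$ (or $[w]$) is the element represented by $w$. An $X$-generated inverse monoid is presented by a set of relations if it is canonically isomorphic (respecting generators) to the quotient of the free inverse monoid on $X$ by the congruence generated by these relations. A word is reduced if it contains no subword $xx^{-1}$ or $x^{-1}x$ ($x\in X$), and cyclically reduced if it is reduced and its first and last letters are not mutually inverse. Cayley graph: $\mathrm{Cay}(G,X)$ has vertex set $G$ and, for each $g\in G$, $x\in\overline X$, an edge labelled $x$ from $g$ to $g[x]$; its inverse is the edge labelled $x^{-1}$ from $g[x]$ to $g$. A subgraph is a set of vertices and edges closed under endpoints and inversion of edges; $G$ acts on subgraphs by left multiplication. A path is simple if all its vertices are distinct (the empty path at a vertex is simple); a simple cycle is a path ending at its initial vertex such that the initial vertices of all its edges are distinct. The subgraph spanned by a path consists of its edges, their inverses, and all vertices visited. $\Gamma_w$ is the subgraph spanned by the path starting at $1$ and labelled by $w$. Margolis–Meakin expansion: $M(G,X)$ is the inverse monoid of pairs $(\Gamma,g)$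 with $\Gamma$ a finite connected subgraph of $\mathrm{Cay}(G,X)$ containing $1$ and $g$, with $(\Delta,g)(\Xi,h)=(\Delta\cup g\Xi,gh)$ and $(\Delta,g)^{-1}=(g^{-1}\Delta,g^{-1})$; it is $X$-generated via $x\mapsto(\Gamma_x,[x])$. $\xi_G$ is the congruence of $M(G,X)$ generated by all pairs $((\Pi_1,g),(\Pi_2,g))$ with $g\in G$ and $\Pi_1,\Pi_2$ subgraphs spanned by simple paths from $1$ to $g$. $M_{sF}(G,X)=M(G,X)/\xi_G$. A cyclically reduced word $w$ is cyclic with respect to $(G,X)$ if $w$ labels a simple cycle in $\mathrm{Cay}(G,X)$. $\theta_G$ is the set of all pairs $(u,v)$ of non-empty words in $\overline X^*$ such that $uv$ is cyclic with respect to $(G,X)$, and $\theta_G^\sharp$ is the congruence on $M(G,X)$ generated by $\{((\Gamma_u,[u]),(\Gamma_{v^{-1}},[v^{-1}])) : (u,v)\in\theta_G\}$. *)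

theory Defs
  imports "HOL-Algebra.Generated_Groups"
begin

section \<open>Words over the doubled alphabet\<close>

text \<open>The letter \<open>(x, True)\<close> stands for \<open>x\<close> and \<open>(x, False)\<close> for its formal inverse.\<close>

type_synonym 'x letter = "'x \<times> bool"
type_synonym 'x word = "'x letter list"

definition letters :: "'x set \<Rightarrow> 'x letter set" where
  "letters X = X \<times> UNIV"

definition words :: "'x set \<Rightarrow> 'x word set" where
  "words X = lists (letters X)"

definition letter_inv :: "'x letter \<Rightarrow> 'x letter" where
  "letter_inv a = (fst a, \<not> snd a)"

definition word_inv :: "'x word \<Rightarrow> 'x word" where
  "word_inv w = rev (map letter_inv w)"

definition reduced :: "'x word \<Rightarrow> bool" where
  "reduced w \<longleftrightarrow> \<not> (\<exists>p a q. w = p @ [a, letter_inv a] @ q)"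

definition cyclically_reduced :: "'x word \<Rightarrow> bool" where
  "cyclically_reduced w \<longleftrightarrow> reduced w \<and> (w \<noteq> [] \<longrightarrow> last w \<noteq> letter_inv (hd w))"


section \<open>Inverse monoids, congruences and presentations\<close>

definition gen_inverse :: "('s, 'm) monoid_scheme \<Rightarrow> 's \<Rightarrow> 's \<Rightarrow> bool" where
  "gen_inverse S a b \<longleftrightarrow> b \<in> carrier S \<and>
     a \<otimes>\<^bsub>S\<^esub> b \<otimes>\<^bsub>S\<^esub> a = a \<and> b \<otimes>\<^bsub>S\<^esub> a \<otimes>\<^bsub>S\<^esub> b = b"

text \<open>The inversion of an inverse monoid is determined by its multiplication, so the records below
  carry no inverse operation, and monoid congruences and monoid isomorphisms of inverse monoids
  automatically respect inverses.\<close>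

definition inverse_monoid :: "('s, 'm) monoid_scheme \<Rightarrow> bool" where
  "inverse_monoid S \<longleftrightarrow> monoid S \<and> (\<forall>a\<in>carrier S. \<exists>!b. gen_inverse S a b)"

text \<open>Generation as an inverse monoid: no proper inverse submonoid contains all \<open>\<phi> x\<close>.\<close>

definition generated_inverse_monoid ::
    "'x set \<Rightarrow> ('s, 'm) monoid_scheme \<Rightarrow> ('x \<Rightarrow> 's) \<Rightarrow> bool" where
  "generated_inverse_monoid X S \<phi> \<longleftrightarrow> inverse_monoid S \<and> \<phi> \<in> X \<rightarrow> carrier S \<and>
     (\<forall>T. submonoid T S \<and> (\<forall>a\<in>T. \<forall>b. gen_inverse S a b \<longrightarrow> b \<in> T) \<and> \<phi> ` X \<subseteq> T
        \<longrightarrow> T = carrier S)"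

definition congruence :: "('s, 'm) monoid_scheme \<Rightarrow> ('s \<times> 's) set \<Rightarrow> bool" where
  "congruence S c \<longleftrightarrow> equiv (carrier S) c \<and>
     (\<forall>a a' b b'. (a, a') \<in> c \<and> (b, b') \<in> c \<longrightarrow> (a \<otimes>\<^bsub>S\<^esub> b, a' \<otimes>\<^bsub>S\<^esub> b') \<in> c)"

definition cong_gen :: "('s, 'm) monoid_scheme \<Rightarrow> ('s \<times> 's) set \<Rightarrow> ('s \<times> 's) set" where
  "cong_gen S R = \<Inter>{c. congruence S c \<and> R \<subseteq> c}"

definition quot_monoid :: "('s, 'm) monoid_scheme \<Rightarrow> ('s \<times> 's) set \<Rightarrow> 's set monoid" where
  "quot_monoid S c = \<lparr>carrier = carrier S // c,
     monoid.mult = (\<lambda>A B. c `` (A <#>\<^bsub>S\<^esub> B)), one = c `` {\<one>\<^bsub>S\<^esub>}\<rparr>"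

definition word_monoid :: "'x set \<Rightarrow> 'x word monoid" where
  "word_monoid X = \<lparr>carrier = words X, monoid.mult = (@), one = []\<rparr>"

text \<open>The Vagner congruence, whose quotient is the free inverse monoid on \<open>X\<close>.\<close>

definition vagner :: "'x set \<Rightarrow> ('x word \<times> 'x word) set" where
  "vagner X = cong_gen (word_monoid X)
     ({(u @ word_inv u @ u, u) |u. u \<in> words X} \<union>
      {(u @ word_inv u @ v @ word_inv v, v @ word_inv v @ u @ word_inv u) |u v.
         u \<in> words X \<and> v \<in> words X})"

definition FIM :: "'x set \<Rightarrow> 'x word set monoid" where
  "FIM X = quot_monoid (word_monoid X) (vagner X)"

definition fim_class :: "'x set \<Rightarrow> 'x word \<Rightarrow> 'x word set" where
  "fim_class X w = vagner X `` {w}"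

text \<open>A relation \<open>u = v\<close> between words is the pair \<open>(u, v)\<close>.\<close>

definition fim_relations_cong ::
    "'x set \<Rightarrow> ('x word \<times> 'x word) set \<Rightarrow> ('x word set \<times> 'x word set) set" where
  "fim_relations_cong X R = cong_gen (FIM X) {(fim_class X u, fim_class X v) |u v. (u, v) \<in> R}"

definition presented_by ::
    "'x set \<Rightarrow> ('s, 'm) monoid_scheme \<Rightarrow> ('x \<Rightarrow> 's) \<Rightarrow> ('x word \<times> 'x word) set \<Rightarrow> bool" where
  "presented_by X S \<phi> R \<longleftrightarrow> generated_inverse_monoid X S \<phi> \<and>
     (\<exists>h \<in> iso (quot_monoid (FIM X) (fim_relations_cong X R)) S.
        \<forall>x\<in>X. h (fim_relations_cong X R `` {fim_class X [(x, True)]}) = \<phi> x)"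


section \<open>Generated groups and their Cayley graphs\<close>

text \<open>The map \<open>f\<close> sends generators to group elements and need not be injective on \<open>X\<close>.\<close>

definition generated_group :: "'x set \<Rightarrow> ('g, 'm) monoid_scheme \<Rightarrow> ('x \<Rightarrow> 'g) \<Rightarrow> bool" where
  "generated_group X G f \<longleftrightarrow> group G \<and> f \<in> X \<rightarrow> carrier G \<and> generate G (f ` X) = carrier G"

definition letter_val :: "('g, 'm) monoid_scheme \<Rightarrow> ('x \<Rightarrow> 'g) \<Rightarrow> 'x letter \<Rightarrow> 'g" where
  "letter_val G f a = (if snd a then f (fst a) else inv\<^bsub>G\<^esub> f (fst a))"

definition word_val :: "('g, 'm) monoid_scheme \<Rightarrow> ('x \<Rightarrow> 'g) \<Rightarrow> 'x word \<Rightarrow> 'g" where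
  "word_val G f w = foldr (\<lambda>a g. letter_val G f a \<otimes>\<^bsub>G\<^esub> g) w \<one>\<^bsub>G\<^esub>"

text \<open>The edge labelled \<open>a\<close> that starts at \<open>g\<close> is \<open>(g, a)\<close>. Edges with the same endpoints but
  different labels are distinct, and an edge is never its own inverse.\<close>

type_synonym ('g, 'x) edge = "'g \<times> 'x letter"

definition cay_edges :: "'x set \<Rightarrow> ('g, 'm) monoid_scheme \<Rightarrow> ('g, 'x) edge set" where
  "cay_edges X G = carrier G \<times> letters X"

definition edge_end :: "('g, 'm) monoid_scheme \<Rightarrow> ('x \<Rightarrow> 'g) \<Rightarrow> ('g, 'x) edge \<Rightarrow> 'g" where
  "edge_end G f e = fst e \<otimes>\<^bsub>G\<^esub> letter_val G f (snd e)"

definition edge_inv :: "('g, 'm) monoid_scheme \<Rightarrow> ('x \<Rightarrow> 'g) \<Rightarrow> ('g, 'x) edge \<Rightarrow> ('g, 'x) edge" where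
  "edge_inv G f e = (edge_end G f e, letter_inv (snd e))"

text \<open>A graph is the pair of its vertex set and its edge set.\<close>

type_synonym ('g, 'x) graph = "'g set \<times> ('g, 'x) edge set"

definition cay_subgraph ::
    "'x set \<Rightarrow> ('g, 'm) monoid_scheme \<Rightarrow> ('x \<Rightarrow> 'g) \<Rightarrow> ('g, 'x) graph \<Rightarrow> bool" where
  "cay_subgraph X G f \<Gamma> \<longleftrightarrow> fst \<Gamma> \<subseteq> carrier G \<and> snd \<Gamma> \<subseteq> cay_edges X G \<and>
     (\<forall>e\<in>snd \<Gamma>. fst e \<in> fst \<Gamma> \<and> edge_end G f e \<in> fst \<Gamma> \<and> edge_inv G f e \<in> snd \<Gamma>)"

definition graph_union :: "('g, 'x) graph \<Rightarrow> ('g, 'x) graph \<Rightarrow> ('g, 'x) graph" where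
  "graph_union \<Gamma> \<Delta> = (fst \<Gamma> \<union> fst \<Delta>, snd \<Gamma> \<union> snd \<Delta>)"

definition graph_translate ::
    "('g, 'm) monoid_scheme \<Rightarrow> 'g \<Rightarrow> ('g, 'x) graph \<Rightarrow> ('g, 'x) graph" where
  "graph_translate G g \<Gamma> =
     ((\<lambda>h. g \<otimes>\<^bsub>G\<^esub> h) ` fst \<Gamma>, (\<lambda>e. (g \<otimes>\<^bsub>G\<^esub> fst e, snd e)) ` snd \<Gamma>)"

text \<open>\<open>cay_path X G f g p h\<close>: the list of edges \<open>p\<close> is a path from \<open>g\<close> to \<open>h\<close>.\<close>

fun cay_path :: "'x set \<Rightarrow> ('g, 'm) monoid_scheme \<Rightarrow> ('x \<Rightarrow> 'g) \<Rightarrow>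
    'g \<Rightarrow> ('g, 'x) edge list \<Rightarrow> 'g \<Rightarrow> bool" where
  "cay_path X G f g [] h \<longleftrightarrow> g \<in> carrier G \<and> h = g"
| "cay_path X G f g (e # p) h \<longleftrightarrow>
     e \<in> cay_edges X G \<and> fst e = g \<and> cay_path X G f (edge_end G f e) p h"

definition path_label :: "('g, 'x) edge list \<Rightarrow> 'x word" where
  "path_label p = map snd p"

definition path_vertices ::
    "('g, 'm) monoid_scheme \<Rightarrow> ('x \<Rightarrow> 'g) \<Rightarrow> 'g \<Rightarrow> ('g, 'x) edge list \<Rightarrow> 'g list" where
  "path_vertices G f g p = g # map (edge_end G f) p"

definition simple_cay_path :: "'x set \<Rightarrow> ('g, 'm) monoid_scheme \<Rightarrow> ('x \<Rightarrow> 'g) \<Rightarrow>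
    'g \<Rightarrow> ('g, 'x) edge list \<Rightarrow> 'g \<Rightarrow> bool" where
  "simple_cay_path X G f g p h \<longleftrightarrow> cay_path X G f g p h \<and> distinct (path_vertices G f g p)"

definition simple_cay_cycle :: "'x set \<Rightarrow> ('g, 'm) monoid_scheme \<Rightarrow> ('x \<Rightarrow> 'g) \<Rightarrow>
    'g \<Rightarrow> ('g, 'x) edge list \<Rightarrow> bool" where
  "simple_cay_cycle X G f g p \<longleftrightarrow> cay_path X G f g p g \<and> distinct (map fst p)"

definition path_span ::
    "('g, 'm) monoid_scheme \<Rightarrow> ('x \<Rightarrow> 'g) \<Rightarrow> 'g \<Rightarrow> ('g, 'x) edge list \<Rightarrow> ('g, 'x) graph" where
  "path_span G f g p = (set (path_vertices G f g p), set p \<union> edge_inv G f ` set p)"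

fun path_from :: "('g, 'm) monoid_scheme \<Rightarrow> ('x \<Rightarrow> 'g) \<Rightarrow> 'g \<Rightarrow> 'x word \<Rightarrow> ('g, 'x) edge list" where
  "path_from G f g [] = []"
| "path_from G f g (a # w) = (g, a) # path_from G f (g \<otimes>\<^bsub>G\<^esub> letter_val G f a) w"

text \<open>The graph \<open>\<Gamma>\<^sub>w\<close>.\<close>

definition word_graph :: "('g, 'm) monoid_scheme \<Rightarrow> ('x \<Rightarrow> 'g) \<Rightarrow> 'x word \<Rightarrow> ('g, 'x) graph" where
  "word_graph G f w = path_span G f \<one>\<^bsub>G\<^esub> (path_from G f \<one>\<^bsub>G\<^esub> w)"

definition connected_subgraph ::
    "'x set \<Rightarrow> ('g, 'm) monoid_scheme \<Rightarrow> ('x \<Rightarrow> 'g) \<Rightarrow> ('g, 'x) graph \<Rightarrow> bool" where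
  "connected_subgraph X G f \<Gamma> \<longleftrightarrow> cay_subgraph X G f \<Gamma> \<and>
     (\<forall>g\<in>fst \<Gamma>. \<forall>h\<in>fst \<Gamma>. \<exists>p. cay_path X G f g p h \<and> set p \<subseteq> snd \<Gamma>)"


section \<open>The Margolis--Meakin expansion and its quotients\<close>

text \<open>The inverse of \<open>(\<Delta>, g)\<close> in this monoid is
  \<open>(graph_translate G (inv\<^bsub>G\<^esub> g) \<Delta>, inv\<^bsub>G\<^esub> g)\<close>.\<close>

definition MM :: "'x set \<Rightarrow> ('g, 'm) monoid_scheme \<Rightarrow> ('x \<Rightarrow> 'g) \<Rightarrow>
    (('g, 'x) graph \<times> 'g) monoid" where
  "MM X G f = \<lparr>
     carrier = {(\<Gamma>, g). connected_subgraph X G f \<Gamma> \<and> finite (fst \<Gamma>) \<and> finite (snd \<Gamma>) \<and>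
                  \<one>\<^bsub>G\<^esub> \<in> fst \<Gamma> \<and> g \<in> fst \<Gamma>},
     monoid.mult = (\<lambda>(\<Delta>, g) (\<Xi>, h). (graph_union \<Delta> (graph_translate G g \<Xi>), g \<otimes>\<^bsub>G\<^esub> h)),
     one = (({\<one>\<^bsub>G\<^esub>}, {}), \<one>\<^bsub>G\<^esub>)\<rparr>"

definition MM_word :: "('g, 'm) monoid_scheme \<Rightarrow> ('x \<Rightarrow> 'g) \<Rightarrow> 'x word \<Rightarrow> ('g, 'x) graph \<times> 'g" where
  "MM_word G f w = (word_graph G f w, word_val G f w)"

definition xi_cong :: "'x set \<Rightarrow> ('g, 'm) monoid_scheme \<Rightarrow> ('x \<Rightarrow> 'g) \<Rightarrow>
    ((('g, 'x) graph \<times> 'g) \<times> (('g, 'x) graph \<times> 'g)) set" where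
  "xi_cong X G f = cong_gen (MM X G f)
     {((path_span G f \<one>\<^bsub>G\<^esub> p, g), (path_span G f \<one>\<^bsub>G\<^esub> q, g)) |p q g.
        g \<in> carrier G \<and> simple_cay_path X G f \<one>\<^bsub>G\<^esub> p g \<and> simple_cay_path X G f \<one>\<^bsub>G\<^esub> q g}"

definition MsF :: "'x set \<Rightarrow> ('g, 'm) monoid_scheme \<Rightarrow> ('x \<Rightarrow> 'g) \<Rightarrow>
    (('g, 'x) graph \<times> 'g) set monoid" where
  "MsF X G f = quot_monoid (MM X G f) (xi_cong X G f)"

definition MsF_gen :: "'x set \<Rightarrow> ('g, 'm) monoid_scheme \<Rightarrow> ('x \<Rightarrow> 'g) \<Rightarrow>
    'x \<Rightarrow> (('g, 'x) graph \<times> 'g) set" where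
  "MsF_gen X G f x = xi_cong X G f `` {MM_word G f [(x, True)]}"

definition cyclic_word :: "'x set \<Rightarrow> ('g, 'm) monoid_scheme \<Rightarrow> ('x \<Rightarrow> 'g) \<Rightarrow> 'x word \<Rightarrow> bool" where
  "cyclic_word X G f w \<longleftrightarrow> cyclically_reduced w \<and>
     (\<exists>g p. simple_cay_cycle X G f g p \<and> path_label p = w)"

definition theta :: "'x set \<Rightarrow> ('g, 'm) monoid_scheme \<Rightarrow> ('x \<Rightarrow> 'g) \<Rightarrow> ('x word \<times> 'x word) set" where
  "theta X G f = {(u, v). u \<in> words X \<and> v \<in> words X \<and> u \<noteq> [] \<and> v \<noteq> [] \<and>
     cyclic_word X G f (u @ v)}"

definition theta_cong :: "'x set \<Rightarrow> ('g, 'm) monoid_scheme \<Rightarrow> ('x \<Rightarrow> 'g) \<Rightarrow>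
    ((('g, 'x) graph \<times> 'g) \<times> (('g, 'x) graph \<times> 'g)) set" where
  "theta_cong X G f = cong_gen (MM X G f)
     {(MM_word G f u, MM_word G f (word_inv v)) |u v. (u, v) \<in> theta X G f}"

end

theory Submission
  imports Defs
begin

text \<open>The generators of \<open>\<theta>\<^sup>\<sharp>\<close> are among those of \<open>\<xi>\<close>, because cutting a simple cycle at two vertices
  gives two coterminal simple paths. Conversely, given two coterminal simple paths with different
  first edges, cut the first one where it first meets the second again: the initial pieces bound a
  simple cycle, and the remaining pieces are shorter coterminal simple paths, so induction applies.
  For the presentation, compare kernels on the monoid of words. Every pair \<open>(\<Gamma>, g)\<close> is the value of
  a word, and relations (i) alone already identify words with the same value in \<open>M(G, X)\<close>, since they
  turn all words that are trivial in \<open>G\<close> into idempotents.\<close>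

section \<open>Congruences and quotients of monoids\<close>

text \<open>Cutting at the first return makes the two initial pieces meet only at their ends.
  Different first edges matter because a single edge run forth and back is the only simple closed
  walk of length at least two whose label is not cyclically reduced. In the presentation, the
  obstacle is that one graph can be traversed in entirely different orders, while the Vagner
  relations by themselves only handle backtracking. Relations (i) close this gap: two routes to the
  same vertex may be exchanged at the cost of factors trivial in G, which are idempotent and
  commute.\<close>

lemma congruenceD:
  assumes "congruence S c"
  shows congruence_equiv: "equiv (carrier S) c"
    and congruence_mult: "(a, a') \<in> c \<Longrightarrow> (b, b') \<in> c \<Longrightarrow> (a \<otimes>\<^bsub>S\<^esub> b, a' \<otimes>\<^bsub>S\<^esub> b') \<in> c"
    and congruence_refl: "a \<in> carrier S \<Longrightarrow> (a, a) \<in> c"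
    and congruence_sym: "(a, b) \<in> c \<Longrightarrow> (b, a) \<in> c"
    and congruence_trans: "(a, b) \<in> c \<Longrightarrow> (b, d) \<in> c \<Longrightarrow> (a, d) \<in> c"
    and congruence_carrier: "(a, b) \<in> c \<Longrightarrow> a \<in> carrier S \<and> b \<in> carrier S"
proof -
  have e: "refl_on (carrier S) c" "sym c" "trans c" "c \<subseteq> carrier S \<times> carrier S"
    using assms by (auto simp: congruence_def equiv_def)
  show "equiv (carrier S) c" using assms by (simp add: congruence_def)
  show "(a, a') \<in> c \<Longrightarrow> (b, b') \<in> c \<Longrightarrow> (a \<otimes>\<^bsub>S\<^esub> b, a' \<otimes>\<^bsub>S\<^esub> b') \<in> c"
    using assms by (auto simp: congruence_def)
  show "a \<in> carrier S \<Longrightarrow> (a, a) \<in> c" using e by (auto simp: refl_on_def)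
  show "(a, b) \<in> c \<Longrightarrow> (b, a) \<in> c" using e by (auto dest: symD)
  show "(a, b) \<in> c \<Longrightarrow> (b, d) \<in> c \<Longrightarrow> (a, d) \<in> c" using e by (auto dest: transD)
  show "(a, b) \<in> c \<Longrightarrow> a \<in> carrier S \<and> b \<in> carrier S" using e by auto
qed

lemma congruenceI:
  assumes "c \<subseteq> carrier S \<times> carrier S"
    and "\<And>a. a \<in> carrier S \<Longrightarrow> (a, a) \<in> c"
    and "\<And>a b. (a, b) \<in> c \<Longrightarrow> (b, a) \<in> c"
    and "\<And>a b d. (a, b) \<in> c \<Longrightarrow> (b, d) \<in> c \<Longrightarrow> (a, d) \<in> c"
    and "\<And>a a' b b'. (a, a') \<in> c \<Longrightarrow> (b, b') \<in> c \<Longrightarrow> (a \<otimes>\<^bsub>S\<^esub> b, a' \<otimes>\<^bsub>S\<^esub> b') \<in> c"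
  shows "congruence S c"
proof -
  have "equiv (carrier S) c"
  proof (rule equivI)
    show "refl_on (carrier S) c" using assms(2) by (rule refl_onI)
    show "sym c" using assms(3) by (rule symI)
    show "trans c" using assms(4) by (rule transI)
  qed (fact assms(1))
  then show ?thesis using assms(5) by (simp add: congruence_def)
qed

lemma cong_gen_incl: "R \<subseteq> cong_gen S R"
  by (auto simp: cong_gen_def)

lemma cong_gen_least: "congruence S c \<Longrightarrow> R \<subseteq> c \<Longrightarrow> cong_gen S R \<subseteq> c"
  by (auto simp: cong_gen_def)

text \<open>The total relation on the carrier is a congruence containing \<open>R\<close>, so the
  intersection is over a nonempty family and stays inside the carrier.\<close>

lemma congruence_cong_gen:
  assumes "monoid S" "R \<subseteq> carrier S \<times> carrier S"
  shows "congruence S (cong_gen S R)"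
proof -
  have total: "congruence S (carrier S \<times> carrier S)"
    by (rule congruenceI) (auto intro: monoid.m_closed[OF assms(1)])
  show ?thesis
  proof (rule congruenceI)
    show "cong_gen S R \<subseteq> carrier S \<times> carrier S"
      by (rule cong_gen_least[OF total assms(2)])
  next
    fix a b d assume "(a, b) \<in> cong_gen S R" "(b, d) \<in> cong_gen S R"
    then show "(a, d) \<in> cong_gen S R"
      by (auto simp: cong_gen_def intro: congruence_trans)
  qed (auto simp: cong_gen_def intro: congruence_refl congruence_sym congruence_mult)
qed

lemma quot_monoid_simps:
  "carrier (quot_monoid S c) = (\<lambda>a. c `` {a}) ` carrier S"
  "\<one>\<^bsub>quot_monoid S c\<^esub> = c `` {\<one>\<^bsub>S\<^esub>}"
  by (auto simp: quot_monoid_def quotient_def)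

lemma congruence_class_eq_iff:
  "congruence S c \<Longrightarrow> a \<in> carrier S \<Longrightarrow> b \<in> carrier S \<Longrightarrow> c `` {a} = c `` {b} \<longleftrightarrow> (a, b) \<in> c"
  by (simp add: eq_equiv_class_iff[OF congruence_equiv])

text \<open>The set product of two classes may be a proper part of a class. Closing it under
  \<open>c\<close> fills the class, and compatibility ensures that only one class is met.\<close>

lemma quot_monoid_mult:
  assumes "congruence S c" "a \<in> carrier S" "b \<in> carrier S"
  shows "c `` {a} \<otimes>\<^bsub>quot_monoid S c\<^esub> c `` {b} = c `` {a \<otimes>\<^bsub>S\<^esub> b}"
proof -
  have "c `` (c `` {a} <#>\<^bsub>S\<^esub> c `` {b}) = c `` {a \<otimes>\<^bsub>S\<^esub> b}"
    (is "?L = ?R")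
  proof
    show "?L \<subseteq> ?R"
    proof
      fix z assume "z \<in> ?L"
      then obtain x y where "(a, x) \<in> c" "(b, y) \<in> c" "(x \<otimes>\<^bsub>S\<^esub> y, z) \<in> c"
        by (auto simp: set_mult_def)
      then show "z \<in> ?R"
        using congruence_mult[OF assms(1)] congruence_trans[OF assms(1)] by blast
    qed
    show "?R \<subseteq> ?L"
      using congruence_refl[OF assms(1)] assms(2,3) by (auto simp: set_mult_def)
  qed
  then show ?thesis by (simp add: quot_monoid_def)
qed

lemma monoid_quot_monoid:
  assumes "monoid S" "congruence S c"
  shows "monoid (quot_monoid S c)"
proof -
  interpret monoid S by fact
  show ?thesis
    by (rule monoidI) (auto simp: quot_monoid_simps quot_monoid_mult[OF assms(2)] m_assoc)
qed

lemma quot_class_hom: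
  "congruence S c \<Longrightarrow> (\<lambda>a. c `` {a}) \<in> hom S (quot_monoid S c)"
  by (auto simp: hom_def quot_monoid_simps quot_monoid_mult)

section \<open>Transport of congruences along homomorphisms\<close>

lemma congruence_vimage:
  assumes "monoid M" "\<phi> \<in> hom M N" "congruence N c"
  shows "congruence M {(a, b). a \<in> carrier M \<and> b \<in> carrier M \<and> (\<phi> a, \<phi> b) \<in> c}"
  by (rule congruenceI)
    (use assms in \<open>auto simp: hom_def Pi_def monoid.m_closed congruence_refl
      intro: congruence_sym congruence_trans congruence_mult\<close>)

text \<open>Transitivity is the delicate law: two pairs may meet only after applying
  \<open>\<phi>\<close>, in \<open>\<phi> b = \<phi> b'\<close>. Since the kernel of
  \<open>\<phi>\<close> lies in \<open>k\<close>, the elements \<open>b\<close> and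
  \<open>b'\<close> are then related and the pairs compose.\<close>

lemma congruence_image:
  assumes "\<phi> \<in> hom M N" "\<phi> ` carrier M = carrier N" "congruence M k"
    and "\<And>a b. a \<in> carrier M \<Longrightarrow> b \<in> carrier M \<Longrightarrow> \<phi> a = \<phi> b \<Longrightarrow> (a, b) \<in> k"
  shows "congruence N {(\<phi> a, \<phi> b) |a b. (a, b) \<in> k}"
proof (rule congruenceI)
  note k = congruenceD[OF assms(3)]
  show "{(\<phi> a, \<phi> b) |a b. (a, b) \<in> k} \<subseteq> carrier N \<times> carrier N"
    using k(6) assms(2) by blast
  show "(y, y) \<in> {(\<phi> a, \<phi> b) |a b. (a, b) \<in> k}" if "y \<in> carrier N" for y
    using that k(3) unfolding assms(2)[symmetric] by blast
  show "(y, x) \<in> {(\<phi> a, \<phi> b) |a b. (a, b) \<in> k}"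
    if "(x, y) \<in> {(\<phi> a, \<phi> b) |a b. (a, b) \<in> k}" for x y
    using that k(4) by blast
next
  note k = congruenceD[OF assms(3)]
  fix x y z assume "(x, y) \<in> {(\<phi> a, \<phi> b) |a b. (a, b) \<in> k}" "(y, z) \<in> {(\<phi> a, \<phi> b) |a b. (a, b) \<in> k}"
  then obtain a b b' d where
    *: "(a, b) \<in> k" "(b', d) \<in> k" "x = \<phi> a" "y = \<phi> b" "\<phi> b = \<phi> b'" "z = \<phi> d" by auto
  then have "(b, b') \<in> k" using assms(4) k(6) by blast
  with * have "(a, d) \<in> k" using k(5) by blast
  with * show "(x, z) \<in> {(\<phi> a, \<phi> b) |a b. (a, b) \<in> k}" by blast
next
  note k = congruenceD[OF assms(3)]
  fix x x' y y' assume "(x, x') \<in> {(\<phi> a, \<phi> b) |a b. (a, b) \<in> k}"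
    "(y, y') \<in> {(\<phi> a, \<phi> b) |a b. (a, b) \<in> k}"
  then obtain a a' b b' where
    *: "(a, a') \<in> k" "(b, b') \<in> k" "x = \<phi> a" "x' = \<phi> a'" "y = \<phi> b" "y' = \<phi> b'" by auto
  then have "x \<otimes>\<^bsub>N\<^esub> y = \<phi> (a \<otimes>\<^bsub>M\<^esub> b)" "x' \<otimes>\<^bsub>N\<^esub> y' = \<phi> (a' \<otimes>\<^bsub>M\<^esub> b')"
    using k(6) hom_mult[OF assms(1)] by metis+
  then show "(x \<otimes>\<^bsub>N\<^esub> y, x' \<otimes>\<^bsub>N\<^esub> y') \<in> {(\<phi> a, \<phi> b) |a b. (a, b) \<in> k}"
    using k(2) * by blast
qed

text \<open>The image of \<open>k\<close> is a congruence on \<open>N\<close>, so it contains the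
  generated one as soon as it contains the generators. The kernel condition brings the result back
  to \<open>M\<close>.\<close>

lemma cong_gen_pullback:
  assumes "\<phi> \<in> hom M N" "\<phi> ` carrier M = carrier N" "congruence M k"
    and ker: "\<And>a b. a \<in> carrier M \<Longrightarrow> b \<in> carrier M \<Longrightarrow> \<phi> a = \<phi> b \<Longrightarrow> (a, b) \<in> k"
    and R: "R \<subseteq> {(\<phi> a, \<phi> b) |a b. (a, b) \<in> k}"
    and ab: "a \<in> carrier M" "b \<in> carrier M" "(\<phi> a, \<phi> b) \<in> cong_gen N R"
  shows "(a, b) \<in> k"
proof -
  note k = congruenceD[OF assms(3)]
  have "(\<phi> a, \<phi> b) \<in> {(\<phi> a, \<phi> b) |a b. (a, b) \<in> k}"
    using cong_gen_least[OF congruence_image[OF assms(1-4)] R] ab by blast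
  then obtain a' b' where *: "\<phi> a = \<phi> a'" "\<phi> b = \<phi> b'" "(a', b') \<in> k" by auto
  then have "(a, a') \<in> k" "(b', b) \<in> k" using ker ab k(6) by metis+
  then show ?thesis using * k(5) by blast
qed

lemma iso_of_same_kernel:
  assumes \<phi>: "\<phi> \<in> hom M A" "\<phi> ` carrier M = carrier A"
    and \<psi>: "\<psi> \<in> hom M B" "\<psi> ` carrier M = carrier B"
    and M: "monoid M"
    and ker: "\<And>a b. a \<in> carrier M \<Longrightarrow> b \<in> carrier M \<Longrightarrow> \<phi> a = \<phi> b \<longleftrightarrow> \<psi> a = \<psi> b"
  shows "\<exists>h \<in> iso A B. \<forall>a\<in>carrier M. h (\<phi> a) = \<psi> a"
proof -
  \<comment> \<open>Any preimage will do: the kernels agree, so \<open>\<psi>\<close> takes one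
    value on each fibre of \<open>\<phi>\<close>.\<close>
  define h where "h y = \<psi> (SOME a. a \<in> carrier M \<and> \<phi> a = y)" for y
  have h: "h (\<phi> a) = \<psi> a" if "a \<in> carrier M" for a
  proof -
    have "(SOME b. b \<in> carrier M \<and> \<phi> b = \<phi> a) \<in> carrier M \<and>
        \<phi> (SOME b. b \<in> carrier M \<and> \<phi> b = \<phi> a) = \<phi> a"
      by (rule someI[of _ a]) (use that in simp)
    then show ?thesis unfolding h_def using ker that by blast
  qed
  have "h \<in> hom A B"
  proof (rule homI)
    fix x assume "x \<in> carrier A"
    then show "h x \<in> carrier B"
      using h unfolding \<phi>(2)[symmetric] \<psi>(2)[symmetric] by auto
  next
    fix x y assume "x \<in> carrier A" "y \<in> carrier A"
    then obtain a b where ab: "a \<in> carrier M" "b \<in> carrier M" "x = \<phi> a" "y = \<phi> b"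
      unfolding \<phi>(2)[symmetric] by auto
    then have "a \<otimes>\<^bsub>M\<^esub> b \<in> carrier M" using M by (simp add: monoid.m_closed)
    then show "h (x \<otimes>\<^bsub>A\<^esub> y) = h x \<otimes>\<^bsub>B\<^esub> h y"
      using ab h hom_mult[OF \<phi>(1)] hom_mult[OF \<psi>(1)] by metis
  qed
  moreover have "inj_on h (carrier A)"
    unfolding \<phi>(2)[symmetric] by (rule inj_onI) (use h ker in auto)
  moreover have "h ` carrier A = carrier B"
    unfolding \<phi>(2)[symmetric] \<psi>(2)[symmetric] image_image using h by auto
  ultimately show ?thesis using h by (auto simp: iso_def bij_betw_def)
qed

text \<open>Two inverses b and d of a both equal dab: swapping the idempotents ba and da in b =
  (ba)(da)b gives b = dab, and swapping ab and ad in d = d(ab)(ad) gives d = dab.\<close>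

lemma inverse_monoidI:
  assumes "monoid S"
    and regular: "\<And>a. a \<in> carrier S \<Longrightarrow> \<exists>b. gen_inverse S a b"
    and comm: "\<And>a b. a \<in> carrier S \<Longrightarrow> b \<in> carrier S \<Longrightarrow> a \<otimes>\<^bsub>S\<^esub> a = a \<Longrightarrow> b \<otimes>\<^bsub>S\<^esub> b = b \<Longrightarrow>
      a \<otimes>\<^bsub>S\<^esub> b = b \<otimes>\<^bsub>S\<^esub> a"
  shows "inverse_monoid S"
proof -
  interpret monoid S by fact
  have "b = d" if "a \<in> carrier S" "gen_inverse S a b" "gen_inverse S a d" for a b d
  proof -
    have b: "b \<in> carrier S" "a \<otimes>\<^bsub>S\<^esub> b \<otimes>\<^bsub>S\<^esub> a = a" "b \<otimes>\<^bsub>S\<^esub> a \<otimes>\<^bsub>S\<^esub> b = b"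
      and d: "d \<in> carrier S" "a \<otimes>\<^bsub>S\<^esub> d \<otimes>\<^bsub>S\<^esub> a = a" "d \<otimes>\<^bsub>S\<^esub> a \<otimes>\<^bsub>S\<^esub> d = d"
      using that by (auto simp: gen_inverse_def)
    note [simp] = b(1) d(1) that(1)
    have idem: "(a \<otimes>\<^bsub>S\<^esub> b) \<otimes>\<^bsub>S\<^esub> (a \<otimes>\<^bsub>S\<^esub> b) = a \<otimes>\<^bsub>S\<^esub> b" "(b \<otimes>\<^bsub>S\<^esub> a) \<otimes>\<^bsub>S\<^esub> (b \<otimes>\<^bsub>S\<^esub> a) = b \<otimes>\<^bsub>S\<^esub> a"
      "(a \<otimes>\<^bsub>S\<^esub> d) \<otimes>\<^bsub>S\<^esub> (a \<otimes>\<^bsub>S\<^esub> d) = a \<otimes>\<^bsub>S\<^esub> d" "(d \<otimes>\<^bsub>S\<^esub> a) \<otimes>\<^bsub>S\<^esub> (d \<otimes>\<^bsub>S\<^esub> a) = d \<otimes>\<^bsub>S\<^esub> a"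
      using b(2,3) d(2,3) by (simp_all add: m_assoc[symmetric])
    have "b = b \<otimes>\<^bsub>S\<^esub> (a \<otimes>\<^bsub>S\<^esub> d \<otimes>\<^bsub>S\<^esub> a) \<otimes>\<^bsub>S\<^esub> b" using b(3) d(2) by simp
    also have "\<dots> = (b \<otimes>\<^bsub>S\<^esub> a) \<otimes>\<^bsub>S\<^esub> (d \<otimes>\<^bsub>S\<^esub> a) \<otimes>\<^bsub>S\<^esub> b" by (simp add: m_assoc)
    also have "\<dots> = (d \<otimes>\<^bsub>S\<^esub> a) \<otimes>\<^bsub>S\<^esub> (b \<otimes>\<^bsub>S\<^esub> a) \<otimes>\<^bsub>S\<^esub> b"
      using comm[of "b \<otimes>\<^bsub>S\<^esub> a" "d \<otimes>\<^bsub>S\<^esub> a"] idem by simp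
    also have "\<dots> = d \<otimes>\<^bsub>S\<^esub> a \<otimes>\<^bsub>S\<^esub> (b \<otimes>\<^bsub>S\<^esub> a \<otimes>\<^bsub>S\<^esub> b)" by (simp add: m_assoc)
    finally have 1: "b = d \<otimes>\<^bsub>S\<^esub> a \<otimes>\<^bsub>S\<^esub> b" using b(3) by simp
    have "d = d \<otimes>\<^bsub>S\<^esub> (a \<otimes>\<^bsub>S\<^esub> b \<otimes>\<^bsub>S\<^esub> a) \<otimes>\<^bsub>S\<^esub> d" using d(3) b(2) by simp
    also have "\<dots> = d \<otimes>\<^bsub>S\<^esub> ((a \<otimes>\<^bsub>S\<^esub> b) \<otimes>\<^bsub>S\<^esub> (a \<otimes>\<^bsub>S\<^esub> d))" by (simp add: m_assoc)
    also have "\<dots> = d \<otimes>\<^bsub>S\<^esub> ((a \<otimes>\<^bsub>S\<^esub> d) \<otimes>\<^bsub>S\<^esub> (a \<otimes>\<^bsub>S\<^esub> b))"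
      using comm[of "a \<otimes>\<^bsub>S\<^esub> b" "a \<otimes>\<^bsub>S\<^esub> d"] idem by simp
    also have "\<dots> = (d \<otimes>\<^bsub>S\<^esub> a \<otimes>\<^bsub>S\<^esub> d) \<otimes>\<^bsub>S\<^esub> a \<otimes>\<^bsub>S\<^esub> b" by (simp add: m_assoc)
    finally show "b = d" using 1 d(3) by simp
  qed
  then show ?thesis unfolding inverse_monoid_def using assms(1) regular by blast
qed


section \<open>Words\<close>

lemma letter_inv_letter_inv [simp]: "letter_inv (letter_inv a) = a"
  by (simp add: letter_inv_def)

lemma letter_inv_in_letters [simp]: "letter_inv a \<in> letters X \<longleftrightarrow> a \<in> letters X"
  by (cases a) (auto simp: letter_inv_def letters_def)

lemma word_inv_simps [simp]:
  "word_inv [] = []"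
  "word_inv (a # w) = word_inv w @ [letter_inv a]"
  "word_inv (u @ v) = word_inv v @ word_inv u"
  "word_inv (word_inv w) = w"
  "length (word_inv w) = length w"
  "word_inv w = [] \<longleftrightarrow> w = []"
  by (simp_all add: word_inv_def rev_map comp_def)

lemma words_simps [simp]:
  "[] \<in> words X"
  "a # w \<in> words X \<longleftrightarrow> a \<in> letters X \<and> w \<in> words X"
  "u @ v \<in> words X \<longleftrightarrow> u \<in> words X \<and> v \<in> words X"
  by (auto simp: words_def)

lemma word_inv_in_words [simp]: "word_inv w \<in> words X \<longleftrightarrow> w \<in> words X"
  by (induction w) auto

section \<open>The free inverse monoid as a quotient of words\<close>

lemma word_monoid_simps [simp]:
  "carrier (word_monoid X) = words X" "u \<otimes>\<^bsub>word_monoid X\<^esub> v = u @ v" "\<one>\<^bsub>word_monoid X\<^esub> = []"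
  by (simp_all add: word_monoid_def)

lemma monoid_word_monoid: "monoid (word_monoid X)"
  by (rule monoidI) simp_all

lemma congruence_vagner: "congruence (word_monoid X) (vagner X)"
  unfolding vagner_def by (rule congruence_cong_gen[OF monoid_word_monoid]) auto

lemma monoid_FIM: "monoid (FIM X)"
  unfolding FIM_def by (rule monoid_quot_monoid[OF monoid_word_monoid congruence_vagner])

lemma fim_class_hom: "fim_class X \<in> hom (word_monoid X) (FIM X)"
  using quot_class_hom[OF congruence_vagner] by (simp add: fim_class_def[abs_def] FIM_def)

lemma fim_class_image: "fim_class X ` words X = carrier (FIM X)"
  by (simp add: FIM_def fim_class_def[abs_def] quot_monoid_simps)

lemma fim_class_eq_iff:
  "u \<in> words X \<Longrightarrow> v \<in> words X \<Longrightarrow> fim_class X u = fim_class X v \<longleftrightarrow> (u, v) \<in> vagner X"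
  unfolding fim_class_def by (rule congruence_class_eq_iff[OF congruence_vagner]) auto

lemma congruence_fim_relations_cong:
  assumes "R \<subseteq> words X \<times> words X"
  shows "congruence (FIM X) (fim_relations_cong X R)"
  unfolding fim_relations_cong_def
  by (rule congruence_cong_gen[OF monoid_FIM]) (use assms fim_class_image in blast)


section \<open>Paths in Cayley graphs\<close>

locale cayley = group G for X :: "'x set" and G :: "('g, 'm) monoid_scheme" (structure)
    and f :: "'x \<Rightarrow> 'g" +
  assumes gen_closed: "f \<in> X \<rightarrow> carrier G"
begin

abbreviation "lval \<equiv> letter_val G f"
abbreviation "val \<equiv> word_val G f"
abbreviation "path \<equiv> path_from G f"

text \<open>A path is determined by its start and its label, so walks are given by a vertex and a
  word. Vertices form a list because simplicity counts repetitions; edges form a set closed under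
  inversion because only the spanned subgraph matters.\<close>

definition walk_vertices :: "'g \<Rightarrow> 'x word \<Rightarrow> 'g list" where
  "walk_vertices g w = path_vertices G f g (path g w)"

definition walk_edges :: "'g \<Rightarrow> 'x word \<Rightarrow> ('g, 'x) edge set" where
  "walk_edges g w = set (path g w) \<union> edge_inv G f ` set (path g w)"

lemma lval_closed [simp]: "a \<in> letters X \<Longrightarrow> lval a \<in> carrier G"
  using gen_closed by (auto simp: letter_val_def letters_def)

lemma lval_letter_inv [simp]: "a \<in> letters X \<Longrightarrow> lval (letter_inv a) = inv lval a"
  using funcset_mem[OF gen_closed] by (auto simp: letter_val_def letter_inv_def letters_def)

lemma val_Nil [simp]: "val [] = \<one>"
  and val_Cons [simp]: "val (a # w) = lval a \<otimes> val w"
  by (simp_all add: word_val_def)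

lemma val_closed [simp]: "w \<in> words X \<Longrightarrow> val w \<in> carrier G"
  by (induction w) auto

lemma val_append [simp]:
  "u \<in> words X \<Longrightarrow> v \<in> words X \<Longrightarrow> val (u @ v) = val u \<otimes> val v"
  by (induction u) (auto simp: m_assoc)

lemma val_word_inv [simp]: "w \<in> words X \<Longrightarrow> val (word_inv w) = inv val w"
  by (induction w) (auto simp: inv_mult_group)

lemma edge_end_simp [simp]: "edge_end G f (g, a) = g \<otimes> lval a"
  by (simp add: edge_end_def)

lemma edge_inv_simp [simp]: "edge_inv G f (g, a) = (g \<otimes> lval a, letter_inv a)"
  by (simp add: edge_inv_def)

lemma cay_edges_iff [simp]: "(g, a) \<in> cay_edges X G \<longleftrightarrow> g \<in> carrier G \<and> a \<in> letters X"
  by (simp add: cay_edges_def)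

lemma edge_inv_edge_inv: "e \<in> cay_edges X G \<Longrightarrow> edge_inv G f (edge_inv G f e) = e"
  by (cases e) (auto simp: m_assoc)

lemma path_append:
  "g \<in> carrier G \<Longrightarrow> u \<in> words X \<Longrightarrow> v \<in> words X \<Longrightarrow>
    path g (u @ v) = path g u @ path (g \<otimes> val u) v"
  by (induction u arbitrary: g) (auto simp: m_assoc)

lemma path_translate:
  "g \<in> carrier G \<Longrightarrow> h \<in> carrier G \<Longrightarrow> w \<in> words X \<Longrightarrow>
    path (g \<otimes> h) w = map (\<lambda>e. (g \<otimes> fst e, snd e)) (path h w)"
  by (induction w arbitrary: h) (auto simp: m_assoc)

lemma path_in_cay_edges:
  "g \<in> carrier G \<Longrightarrow> w \<in> words X \<Longrightarrow> set (path g w) \<subseteq> cay_edges X G"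
  by (induction w arbitrary: g) auto

lemma cay_path_iff:
  "cay_path X G f g p h \<longleftrightarrow> g \<in> carrier G \<and> path_label p \<in> words X \<and>
    p = path g (path_label p) \<and> h = g \<otimes> val (path_label p)"
proof (induction p arbitrary: g)
  case (Cons e p)
  obtain k a where "e = (k, a)" by (cases e)
  then show ?case by (auto simp: Cons.IH path_label_def m_assoc)
qed (auto simp: path_label_def)

lemma path_label_path [simp]: "path_label (path g w) = w"
  by (induction w arbitrary: g) (auto simp: path_label_def)

lemma cay_path_path:
  "g \<in> carrier G \<Longrightarrow> w \<in> words X \<Longrightarrow> cay_path X G f g (path g w) (g \<otimes> val w)"
  by (simp add: cay_path_iff)

lemma walk_vertices_Nil [simp]: "walk_vertices g [] = [g]"
  and walk_vertices_Cons [simp]: "walk_vertices g (a # w) = g # walk_vertices (g \<otimes> lval a) w"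
  by (simp_all add: walk_vertices_def path_vertices_def)

lemma walk_vertices_not_Nil [simp]: "walk_vertices g w \<noteq> []"
  by (cases w) auto

lemma hd_walk_vertices [simp]: "hd (walk_vertices g w) = g"
  by (cases w) auto

lemma last_walk_vertices:
  "g \<in> carrier G \<Longrightarrow> w \<in> words X \<Longrightarrow> last (walk_vertices g w) = g \<otimes> val w"
  by (induction w arbitrary: g) (auto simp: m_assoc)

text \<open>The starts of the edges omit only the end of the walk, so simplicity of a cycle becomes
  distinctness of the \<open>butlast\<close> of its vertex list.\<close>

lemma map_fst_path: "map fst (path g w) = butlast (walk_vertices g w)"
  by (induction w arbitrary: g) auto

lemma walk_vertices_append:
  "g \<in> carrier G \<Longrightarrow> u \<in> words X \<Longrightarrow> v \<in> words X \<Longrightarrow>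
    walk_vertices g (u @ v) = butlast (walk_vertices g u) @ walk_vertices (g \<otimes> val u) v"
  by (induction u arbitrary: g) (auto simp: m_assoc)

lemma walk_vertices_translate:
  "g \<in> carrier G \<Longrightarrow> h \<in> carrier G \<Longrightarrow> w \<in> words X \<Longrightarrow>
    walk_vertices (g \<otimes> h) w = map (\<lambda>k. g \<otimes> k) (walk_vertices h w)"
  by (induction w arbitrary: h) (auto simp: m_assoc)

lemma walk_vertices_closed:
  "g \<in> carrier G \<Longrightarrow> w \<in> words X \<Longrightarrow> set (walk_vertices g w) \<subseteq> carrier G"
  by (induction w arbitrary: g) auto

text \<open>Left translation is injective, so simplicity may be tested from the identity.\<close>

lemma distinct_walk_vertices:
  assumes "g \<in> carrier G" "w \<in> words X"
  shows "distinct (walk_vertices g w) \<longleftrightarrow> distinct (walk_vertices \<one> w)"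
    and "distinct (butlast (walk_vertices g w)) \<longleftrightarrow> distinct (butlast (walk_vertices \<one> w))"
proof -
  have inj: "inj_on (\<lambda>k. g \<otimes> k) (set (walk_vertices \<one> w))"
    using walk_vertices_closed[of \<one> w] assms by (intro inj_onI) (auto simp: subset_iff)
  have "set (butlast (walk_vertices \<one> w)) \<subseteq> set (walk_vertices \<one> w)"
    by (auto dest: in_set_butlastD)
  from inj_on_subset[OF inj this] inj
  show "distinct (walk_vertices g w) \<longleftrightarrow> distinct (walk_vertices \<one> w)"
    "distinct (butlast (walk_vertices g w)) \<longleftrightarrow> distinct (butlast (walk_vertices \<one> w))"
    using walk_vertices_translate[of g \<one> w] assms
    by (simp_all add: distinct_map map_butlast[symmetric])
qed

lemma walk_vertices_word_inv:
  "g \<in> carrier G \<Longrightarrow> w \<in> words X \<Longrightarrow>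
    walk_vertices (g \<otimes> val w) (word_inv w) = rev (walk_vertices g w)"
proof (induction w arbitrary: g)
  case (Cons a w)
  let ?h = "g \<otimes> lval a"
  let ?k = "?h \<otimes> val w"
  have a [simp]: "a \<in> letters X" "w \<in> words X" "g \<in> carrier G" using Cons.prems by auto
  have "?k \<otimes> inv val w = ?h" "?h \<otimes> inv lval a = g" by (simp_all add: m_assoc)
  then have "walk_vertices ?k (word_inv w @ [letter_inv a])
      = butlast (rev (walk_vertices ?h w)) @ [?h, g]"
    using walk_vertices_append[of ?k "word_inv w" "[letter_inv a]"] Cons.IH[of ?h] by simp
  also have "butlast (rev (walk_vertices ?h w)) @ [?h, g] = rev (walk_vertices ?h w) @ [g]"
    using append_butlast_last_id[of "rev (walk_vertices ?h w)"] by (simp add: last_rev)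
  finally show ?case using Cons.prems by (simp add: m_assoc)
qed simp

text \<open>Turns a vertex of a walk into a factorisation of its label, the form in which paths are
  later cut.\<close>

lemma in_walk_vertices_iff:
  "g \<in> carrier G \<Longrightarrow> w \<in> words X \<Longrightarrow>
    h \<in> set (walk_vertices g w) \<longleftrightarrow> (\<exists>p q. w = p @ q \<and> h = g \<otimes> val p)"
proof (induction w arbitrary: g)
  case (Cons a w)
  have assoc: "g \<otimes> lval a \<otimes> val p = g \<otimes> val (a # p)" if "w = p @ q" for p q
    using Cons.prems that by (simp add: m_assoc)
  have "(\<exists>p q. a # w = p @ q \<and> h = g \<otimes> val p) \<longleftrightarrow>
      h = g \<or> (\<exists>p q. w = p @ q \<and> h = g \<otimes> val (a # p))"
    using Cons.prems(1) unfolding Cons_eq_append_conv by (metis r_one val_Nil)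
  also have "\<dots> \<longleftrightarrow> h = g \<or> (\<exists>p q. w = p @ q \<and> h = g \<otimes> lval a \<otimes> val p)"
    using assoc by metis
  also have "\<dots> \<longleftrightarrow> h \<in> set (walk_vertices g (a # w))"
    using Cons by simp
  finally show ?case by (rule sym)
qed auto

lemma in_path_iff:
  "g \<in> carrier G \<Longrightarrow> w \<in> words X \<Longrightarrow>
    (h, b) \<in> set (path g w) \<longleftrightarrow> (\<exists>p q. w = p @ b # q \<and> h = g \<otimes> val p)"
proof (induction w arbitrary: g)
  case (Cons a w)
  have assoc: "g \<otimes> lval a \<otimes> val p = g \<otimes> val (a # p)" if "w = p @ b # q" for p q
    using Cons.prems that by (simp add: m_assoc)
  have "(\<exists>p q. a # w = p @ b # q \<and> h = g \<otimes> val p) \<longleftrightarrow>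
      h = g \<and> b = a \<or> (\<exists>p q. w = p @ b # q \<and> h = g \<otimes> val (a # p))"
    using Cons.prems(1) unfolding Cons_eq_append_conv by (metis list.inject r_one val_Nil)
  also have "\<dots> \<longleftrightarrow> h = g \<and> b = a \<or> (\<exists>p q. w = p @ b # q \<and> h = g \<otimes> lval a \<otimes> val p)"
    using assoc by metis
  also have "\<dots> \<longleftrightarrow> (h, b) \<in> set (path g (a # w))"
    using Cons by auto
  finally show ?case by (rule sym)
qed auto

section \<open>Edge sets of walks and the graphs spanned by words\<close>

lemma walk_edges_Nil [simp]: "walk_edges g [] = {}"
  by (simp add: walk_edges_def)

lemma finite_walk_edges [simp]: "finite (walk_edges g w)"
  by (simp add: walk_edges_def)

lemma walk_edges_append:
  "g \<in> carrier G \<Longrightarrow> u \<in> words X \<Longrightarrow> v \<in> words X \<Longrightarrow>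
    walk_edges g (u @ v) = walk_edges g u \<union> walk_edges (g \<otimes> val u) v"
  by (auto simp: walk_edges_def path_append)

lemma set_path_word_inv:
  "g \<in> carrier G \<Longrightarrow> w \<in> words X \<Longrightarrow>
    set (path (g \<otimes> val w) (word_inv w)) = edge_inv G f ` set (path g w)"
proof (induction w arbitrary: g)
  case (Cons a w)
  then show ?case using Cons.IH[of "g \<otimes> lval a"] by (simp add: path_append m_assoc)
qed simp

lemma walk_edges_word_inv:
  assumes "g \<in> carrier G" "w \<in> words X"
  shows "walk_edges (g \<otimes> val w) (word_inv w) = walk_edges g w"
proof -
  have "edge_inv G f ` edge_inv G f ` set (path g w) = set (path g w)"
    using path_in_cay_edges[OF assms] edge_inv_edge_inv by (force simp: image_image)
  then show ?thesis using assms by (auto simp: walk_edges_def set_path_word_inv)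
qed

lemma word_graph_conv: "word_graph G f w = (set (walk_vertices \<one> w), walk_edges \<one> w)"
  by (simp add: word_graph_def path_span_def walk_vertices_def walk_edges_def)

text \<open>The edge set is closed under inversion, so every end of an edge is also a start;
  \<open>insert g\<close> matters only for the empty word. Hence the edges and the start determine
  the graph.\<close>

lemma walk_vertices_conv_edges:
  assumes "g \<in> carrier G" "w \<in> words X"
  shows "set (walk_vertices g w) = insert g (fst ` walk_edges g w)"
proof -
  have "set (walk_vertices g w) = insert g (edge_end G f ` set (path g w))"
    by (simp add: walk_vertices_def path_vertices_def)
  moreover have "fst ` edge_inv G f ` set (path g w) = edge_end G f ` set (path g w)"
    by (simp add: image_image edge_inv_def)
  moreover have "fst ` set (path g w) \<subseteq> set (walk_vertices g w)"
    using arg_cong[OF map_fst_path, of set] by (auto dest: in_set_butlastD)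
  ultimately show ?thesis by (auto simp: walk_edges_def image_Un)
qed

lemma word_graph_eqI:
  "u \<in> words X \<Longrightarrow> v \<in> words X \<Longrightarrow> walk_edges \<one> u = walk_edges \<one> v \<Longrightarrow>
    word_graph G f u = word_graph G f v"
  by (simp add: word_graph_conv walk_vertices_conv_edges)

lemma walk_edges_translate:
  assumes "g \<in> carrier G" "w \<in> words X"
  shows "walk_edges g w = (\<lambda>e. (g \<otimes> fst e, snd e)) ` walk_edges \<one> w"
proof -
  have "edge_inv G f ((\<lambda>e. (g \<otimes> fst e, snd e)) e) = (\<lambda>e. (g \<otimes> fst e, snd e)) (edge_inv G f e)"
    if "e \<in> set (path \<one> w)" for e
  proof -
    have "e \<in> cay_edges X G" using that path_in_cay_edges[of \<one> w] assms by auto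
    then show ?thesis using assms by (cases e) (auto simp: m_assoc)
  qed
  then have "edge_inv G f ` (\<lambda>e. (g \<otimes> fst e, snd e)) ` set (path \<one> w)
      = (\<lambda>e. (g \<otimes> fst e, snd e)) ` edge_inv G f ` set (path \<one> w)"
    unfolding image_image by (rule image_cong[OF refl])
  then show ?thesis
    using path_translate[of g \<one> w] assms by (simp add: walk_edges_def image_Un)
qed

lemma word_graph_append:
  assumes "u \<in> words X" "v \<in> words X"
  shows "word_graph G f (u @ v) =
    graph_union (word_graph G f u) (graph_translate G (val u) (word_graph G f v))"
proof -
  have "set (walk_vertices \<one> (u @ v)) =
      set (walk_vertices \<one> u) \<union> (\<lambda>h. val u \<otimes> h) ` set (walk_vertices \<one> v)"
  proof -
    \<comment> \<open>\<open>walk_vertices_append\<close> drops the end \<open>val u\<close> of the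
      first walk; it reappears as the start of the second.\<close>
    have "set (walk_vertices \<one> u) = set (butlast (walk_vertices \<one> u)) \<union> {val u}"
      using append_butlast_last_id[OF walk_vertices_not_Nil[of \<one> u]] assms
      by (metis (no_types, lifting) last_walk_vertices l_one one_closed set_append val_closed
          list.set(1) list.set(2))
    moreover have "val u \<in> set (walk_vertices (val u) v)" by (cases v) auto
    ultimately show ?thesis
      using walk_vertices_translate[of "val u" \<one> v] assms by (auto simp: walk_vertices_append)
  qed
  then show ?thesis
    using assms walk_edges_translate[of "val u" v]
    by (simp add: word_graph_conv graph_union_def graph_translate_def walk_edges_append)
qed


section \<open>The Margolis--Meakin expansion\<close>

lemma MM_word_mult:
  "u \<in> words X \<Longrightarrow> v \<in> words X \<Longrightarrow>
    MM_word G f u \<otimes>\<^bsub>MM X G f\<^esub> MM_word G f v = MM_word G f (u @ v)"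
  by (simp add: MM_def MM_word_def word_graph_append)

lemma MM_one: "\<one>\<^bsub>MM X G f\<^esub> = MM_word G f []"
  by (simp add: MM_def MM_word_def word_graph_conv)

lemma MM_word_eqI:
  "u \<in> words X \<Longrightarrow> v \<in> words X \<Longrightarrow> walk_edges \<one> u = walk_edges \<one> v \<Longrightarrow> val u = val v \<Longrightarrow>
    MM_word G f u = MM_word G f v"
  by (auto simp: MM_word_def intro: word_graph_eqI)

lemma connected_word_graph:
  assumes "w \<in> words X"
  shows "connected_subgraph X G f (word_graph G f w)"
proof -
  have "cay_subgraph X G f (word_graph G f w)"
  proof -
    have E: "e \<in> cay_edges X G \<and> edge_inv G f e \<in> walk_edges \<one> w" if "e \<in> walk_edges \<one> w" for e
    proof -
      consider "e \<in> set (path \<one> w)" | d where "d \<in> set (path \<one> w)" "e = edge_inv G f d"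
        using \<open>e \<in> _\<close> by (auto simp: walk_edges_def)
      then show ?thesis
      proof cases
        case 1
        then show ?thesis using path_in_cay_edges[of \<one> w] assms by (auto simp: walk_edges_def)
      next
        case 2
        then have "d \<in> cay_edges X G" using path_in_cay_edges[of \<one> w] assms by auto
        then show ?thesis using 2 edge_inv_edge_inv[of d]
          by (cases d) (auto simp: walk_edges_def)
      qed
    qed
    moreover have "edge_end G f e = fst (edge_inv G f e)" for e
      by (simp add: edge_inv_def)
    ultimately show ?thesis
      using assms walk_vertices_closed[of \<one> w]
      by (auto simp: cay_subgraph_def word_graph_conv walk_vertices_conv_edges intro!: imageI)
  qed
  moreover have "\<exists>p. cay_path X G f g p h \<and> set p \<subseteq> walk_edges \<one> w"
    if gh: "g \<in> set (walk_vertices \<one> w)" "h \<in> set (walk_vertices \<one> w)" for g h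
  proof -
    obtain p p' q q' where w: "w = p @ p'" "w = q @ q'" and g: "g = val p" and h: "h = val q"
      using gh assms by (metis in_walk_vertices_iff l_one one_closed val_closed words_simps(3))
    have [simp]: "p \<in> words X" "p' \<in> words X" "q \<in> words X" "q' \<in> words X"
      using w(1) w(2) assms by (metis words_simps(3))+
    \<comment> \<open>Go back along \<open>p\<close> to the identity, then out along
      \<open>q\<close>. Both parts stay in the graph because \<open>p\<close> and \<open>q\<close>
      are prefixes of \<open>w\<close>.\<close>
    have "walk_edges (val p) (word_inv p) \<subseteq> walk_edges \<one> w"
      using walk_edges_word_inv[of \<one> p] by (simp add: w(1) walk_edges_append)
    moreover have "walk_edges \<one> q \<subseteq> walk_edges \<one> w"
      by (simp add: w(2) walk_edges_append)
    ultimately have "set (path (val p) (word_inv p @ q)) \<subseteq> walk_edges \<one> w"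
      by (auto simp: path_append walk_edges_def)
    moreover have "cay_path X G f g (path (val p) (word_inv p @ q)) h"
      using cay_path_path[of "val p" "word_inv p @ q"] g h by (simp add: m_assoc[symmetric])
    ultimately show ?thesis by blast
  qed
  ultimately show ?thesis by (simp add: connected_subgraph_def word_graph_conv)
qed

lemma MM_word_closed:
  assumes "w \<in> words X" shows "MM_word G f w \<in> carrier (MM X G f)"
  using connected_word_graph[OF assms] assms
  by (auto simp: MM_def MM_word_def word_graph_conv in_walk_vertices_iff
      intro: exI[of _ "[]"] exI[of _ w])

lemma walk_edges_return:
  assumes "w \<in> words X"
  shows "walk_edges \<one> (w @ word_inv w) = walk_edges \<one> w"
  using assms walk_edges_word_inv[of \<one> w] by (simp add: walk_edges_append)

lemma MM_word_surj:
  assumes "m \<in> carrier (MM X G f)"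
  shows "\<exists>w\<in>words X. MM_word G f w = m"
proof -
  obtain V E g where m: "m = ((V, E), g)" by (metis prod.exhaust)
  have conn: "connected_subgraph X G f (V, E)" and fin: "finite E" "finite V"
    and one: "\<one> \<in> V" and g: "g \<in> V"
    using assms by (auto simp: MM_def m)
  have sub: "V \<subseteq> carrier G" "E \<subseteq> cay_edges X G"
      "\<And>e. e \<in> E \<Longrightarrow> fst e \<in> V" "\<And>e. e \<in> E \<Longrightarrow> edge_inv G f e \<in> E"
    using conn by (auto simp: connected_subgraph_def cay_subgraph_def)
  have walk: "\<exists>w\<in>words X. val w = h \<and> walk_edges \<one> w \<subseteq> E" if "h \<in> V" for h
  proof -
    obtain p where "cay_path X G f \<one> p h" "set p \<subseteq> E"
      using conn one \<open>h \<in> V\<close> unfolding connected_subgraph_def fst_conv snd_conv by meson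
    then have "path_label p \<in> words X" "set (path \<one> (path_label p)) \<subseteq> E" "val (path_label p) = h"
      by (auto simp: cay_path_iff)
    then show ?thesis using sub(4) by (auto simp: walk_edges_def intro!: bexI[of _ "path_label p"])
  qed
  \<comment> \<open>A closed walk can be enlarged by excursions without moving its end, so the edges
    are collected one at a time by induction on the finite set \<open>D\<close>.\<close>
  have loop: "\<exists>w\<in>words X. val w = \<one> \<and> walk_edges \<one> w \<subseteq> E \<and> D \<subseteq> walk_edges \<one> w"
    if "D \<subseteq> E" for D
    using finite_subset[OF that fin(1)] that
  proof (induction D rule: finite_induct)
    case empty
    show ?case by (intro bexI[of _ "[]"]) auto
  next
    case (insert e D)
    obtain h a where e: "e = (h, a)" by (cases e)
    have [simp]: "a \<in> letters X" "h \<in> carrier G" using insert.prems sub e by auto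
    obtain w where w: "w \<in> words X" "val w = \<one>" "walk_edges \<one> w \<subseteq> E" "D \<subseteq> walk_edges \<one> w"
      using insert by auto
    obtain u where u: "u \<in> words X" "val u = h" "walk_edges \<one> u \<subseteq> E"
      using walk[of h] sub(3)[of e] insert.prems e by auto
    \<comment> \<open>This excursion reaches the start of \<open>e\<close> inside \<open>E\<close>
      and crosses \<open>e\<close>; run there and back it returns to the identity.\<close>
    define v where "v = u @ [a]"
    have v: "v \<in> words X" "walk_edges \<one> v \<subseteq> E" "e \<in> walk_edges \<one> v"
      using u e insert.prems sub(4)[of e]
      by (auto simp: v_def walk_edges_append) (auto simp: walk_edges_def)
    have "walk_edges \<one> (w @ v @ word_inv v) = walk_edges \<one> w \<union> walk_edges \<one> v"
      using w v walk_edges_return[of v] by (simp add: walk_edges_append)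
    then show ?case using w v by (intro bexI[of _ "w @ v @ word_inv v"]) auto
  qed
  obtain w where w: "w \<in> words X" "val w = \<one>" "walk_edges \<one> w \<subseteq> E" "E \<subseteq> walk_edges \<one> w"
    using loop by blast
  obtain u where u: "u \<in> words X" "val u = g" "walk_edges \<one> u \<subseteq> E"
    using walk[OF g] by blast
  have E: "walk_edges \<one> (w @ u) = E" using w u by (auto simp: walk_edges_append)
  have "set (walk_vertices \<one> (w @ u)) = V"
  proof -
    \<comment> \<open>Connectedness allows no isolated vertex apart from possibly the identity,
      since a walk inside \<open>E\<close> leads to \<open>h\<close>.\<close>
    have "h \<in> insert \<one> (fst ` E)" if h: "h \<in> V" for h
    proof -
      obtain v where v: "v \<in> words X" "val v = h" "walk_edges \<one> v \<subseteq> E"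
        using walk[OF h] by blast
      then have "h \<in> set (walk_vertices \<one> v)" by (auto simp: in_walk_vertices_iff intro: exI[of _ v])
      then show ?thesis using v by (auto simp: walk_vertices_conv_edges)
    qed
    then show ?thesis
      using w(1) u(1) one sub(3) E by (auto simp: walk_vertices_conv_edges)
  qed
  then show ?thesis
    using w u g sub E
    by (intro bexI[of _ "w @ u"]) (auto simp: MM_word_def m word_graph_conv)
qed

lemma MM_word_image: "MM_word G f ` words X = carrier (MM X G f)"
  using MM_word_closed MM_word_surj by blast

lemma MM_word_hom: "MM_word G f \<in> hom (word_monoid X) (MM X G f)"
  using MM_word_closed by (auto simp: hom_def MM_word_mult)

text \<open>Words map onto the carrier, so closure and the monoid laws are inherited from
  concatenation.\<close>

lemma monoid_MM: "monoid (MM X G f)"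
  by (rule monoidI)
    (auto simp: MM_word_image[symmetric] MM_one MM_word_mult)

text \<open>All words with trivial value become commuting idempotents modulo \<open>k\<close>. Hence the class of
  \<open>u @ word_inv u\<close> absorbs \<open>w @ word_inv w\<close> whenever \<open>w\<close> stays inside the graph of \<open>u\<close>, and two
  words with the same graph and value differ by idempotents on both sides.\<close>

lemma MM_word_kernel:
  assumes k: "congruence (word_monoid X) k"
    and reg: "\<And>w. w \<in> words X \<Longrightarrow> (w @ word_inv w @ w, w) \<in> k"
    and comm: "\<And>u v. u \<in> words X \<Longrightarrow> v \<in> words X \<Longrightarrow>
      (u @ word_inv u @ v @ word_inv v, v @ word_inv v @ u @ word_inv u) \<in> k"
    and idem: "\<And>w. w \<in> words X \<Longrightarrow> val w = \<one> \<Longrightarrow> (w @ w, w) \<in> k"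
    and uv: "u \<in> words X" "v \<in> words X" "MM_word G f u = MM_word G f v"
  shows "(u, v) \<in> k"
proof -
  define c where "c w = k `` {w}" for w
  define N where "N w \<longleftrightarrow> w \<in> words X \<and> val w = \<one>" for w
  have c_iff: "c a = c b \<longleftrightarrow> (a, b) \<in> k" if "a \<in> words X" "b \<in> words X" for a b
    unfolding c_def using that by (intro congruence_class_eq_iff[OF k]) auto
  have ctxt: "c (p @ a @ q) = c (p @ b @ q)"
    if "c a = c b" "a \<in> words X" "b \<in> words X" "p \<in> words X" "q \<in> words X" for p a b q
  proof -
    have "(a, b) \<in> k" using that c_iff by blast
    then have "(p @ a @ q, p @ b @ q) \<in> k"
      using congruence_mult[OF k] congruence_refl[OF k] that by (metis word_monoid_simps(1,2))
    then show ?thesis using that by (simp add: c_iff)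
  qed
  have reg_c: "c (w @ word_inv w @ w) = c w" if "w \<in> words X" for w
    using reg[OF that] that by (simp add: c_iff)
  have comm_c: "c (w @ word_inv w @ z @ word_inv z) = c (z @ word_inv z @ w @ word_inv w)"
    if "w \<in> words X" "z \<in> words X" for w z
    using comm[OF that] that by (simp add: c_iff)
  have idem_c: "c (w @ w) = c w" if "N w" for w
    using idem[of w] that by (simp add: c_iff N_def)
  have N_words: "w \<in> words X" if "N w" for w using that by (simp add: N_def)
  have N_inv: "N (word_inv w)" if "N w" for w using that by (simp add: N_def)
  have N_append: "N (w @ z)" if "N w" "N z" for w z using that by (simp add: N_def)
  have N_loop: "N (w @ word_inv z)" if "w \<in> words X" "z \<in> words X" "val w = val z" for w z
    using that by (simp add: N_def)
  have N_loop': "N (word_inv w @ z)" if "w \<in> words X" "z \<in> words X" "val w = val z" for w z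
    using that by (simp add: N_def)
  \<comment> \<open>Doubling w^-1 inside w w^-1 w gives (w w^-1)(w^-1 w). These factors commute by
    \<open>comm_c\<close>, and idempotency of w then leaves w^-1 w w^-1.\<close>
  have self_inv: "c w = c (word_inv w)" if w: "N w" for w
  proof -
    let ?w' = "word_inv w"
    have [simp]: "w \<in> words X" using N_words w by blast
    have "c w = c (w @ ?w' @ w)" by (simp add: reg_c)
    also have "\<dots> = c (w @ ?w' @ ?w' @ w)"
      using ctxt[of ?w' "?w' @ ?w'" w w] idem_c[OF N_inv[OF w]] by simp
    also have "\<dots> = c (?w' @ w @ w @ ?w')" using comm_c[of w ?w'] by simp
    also have "\<dots> = c (?w' @ w @ ?w')"
      using ctxt[of "w @ w" w ?w' ?w'] idem_c[OF w] by simp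
    also have "\<dots> = c ?w'" using reg_c[of ?w'] by simp
    finally show ?thesis .
  qed
  \<comment> \<open>This brings a word trivial in G into the form w w^-1, to which
    \<open>comm_c\<close> applies.\<close>
  have proj: "c w = c (w @ word_inv w)" if w: "N w" for w
    using ctxt[of w "word_inv w" w "[]"] idem_c[OF w] self_inv[OF w] N_words[OF w] by simp
  have N_comm: "c (w @ z) = c (z @ w)" if w: "N w" and z: "N z" for w z
  proof -
    have [simp]: "w \<in> words X" "z \<in> words X" using N_words w z by blast+
    have *: "c (x @ y) = c (x @ word_inv x @ y @ word_inv y)" if "N x" "N y" for x y
    proof -
      have "c (x @ y) = c (x @ word_inv x @ y)"
        using ctxt[of x "x @ word_inv x" "[]" y] proj that N_words by simp
      also have "\<dots> = c (x @ word_inv x @ y @ word_inv y)"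
        using ctxt[of y "y @ word_inv y" "x @ word_inv x" "[]"] proj that N_words by simp
      finally show ?thesis .
    qed
    show ?thesis using *[OF w z] *[OF z w] comm_c[of w z] by simp
  qed
  have prefix: "c (z @ word_inv z @ p @ word_inv p) = c (z @ word_inv z)"
    if "z = p @ q" "z \<in> words X" for z p q
    using ctxt[of "word_inv p @ p @ word_inv p" "word_inv p" "p @ q @ word_inv q" "[]"]
      reg_c[of "word_inv p"] that by simp
  \<comment> \<open>Induction from the right keeps the walk based at the identity. Its last edge is
    traversed by \<open>z\<close> in one direction or the other, which yields a prefix of
    \<open>z\<close> ending where the shortened walk ends.\<close>
  have absorb: "c (z @ word_inv z @ w @ word_inv w) = c (z @ word_inv z)"
    if "z \<in> words X" "w \<in> words X" "walk_edges \<one> w \<subseteq> walk_edges \<one> z" for z w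
    using that(2,3)
  proof (induction w rule: rev_induct)
    case Nil
    then show ?case by simp
  next
    case (snoc a w)
    have [simp]: "z \<in> words X" "w \<in> words X" "a \<in> letters X" using snoc.prems that(1) by auto
    let ?e = "z @ word_inv z"
    have IH: "c (?e @ w @ word_inv w) = c ?e"
      using snoc by (simp add: walk_edges_append)
    have "(val w, a) \<in> walk_edges \<one> z"
      using snoc.prems by (auto simp: walk_edges_append) (auto simp: walk_edges_def)
    then consider "(val w, a) \<in> set (path \<one> z)"
      | h b where "(h, b) \<in> set (path \<one> z)" "(val w, a) = edge_inv G f (h, b)"
      by (auto simp: walk_edges_def)
    then obtain p where p: "p \<in> words X" "val p = val w"
      "c (?e @ p @ [a, letter_inv a] @ word_inv p) = c ?e"
    proof cases
      case 1
      then obtain p q where pq: "z = p @ a # q" "val w = \<one> \<otimes> val p"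
        using in_path_iff[of \<one> z] by auto
      have "p \<in> words X" "q \<in> words X" using pq(1) \<open>z \<in> words X\<close> by simp_all
      then show thesis using that[of p] prefix[of z "p @ [a]" q] pq by simp
    next
      case 2
      then obtain p q where pq: "z = p @ b # q" "h = \<one> \<otimes> val p"
        using in_path_iff[of \<one> z] by auto
      have [simp]: "p \<in> words X" "b \<in> letters X" "q \<in> words X" using pq(1) \<open>z \<in> words X\<close> by simp_all
      \<comment> \<open>Here \<open>a\<close> is the inverse of \<open>b\<close>, so for the prefix
        p b the word to absorb contains b b^-1 b b^-1. Regularity of \<open>b\<close> shortens it to
        a word covered by \<open>prefix\<close>.\<close>
      have "c (?e @ p @ [b, letter_inv b, b, letter_inv b] @ word_inv p)
          = c (?e @ p @ [b, letter_inv b] @ word_inv p)"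
        using ctxt[of "[b, letter_inv b, b]" "[b]" "?e @ p" "letter_inv b # word_inv p"]
          reg_c[of "[b]"] by simp
      then show thesis
        using that[of "p @ [b]"] prefix[of z "p @ [b]" q] pq 2 by simp
    qed
    note [simp] = p(1)
    \<comment> \<open>\<open>r\<close> and \<open>s\<close> translate between the routes
      \<open>w\<close> and \<open>p\<close> to the same vertex. All four words are trivial in G,
      hence commuting idempotents.\<close>
    define r s t n where rstn: "r = word_inv w @ p" "s = word_inv p @ w" "t = [a, letter_inv a]"
      "n = word_inv w @ w"
    have N: "N r" "N s" "N t" "N n"
      using p N_loop'[of w p] N_loop'[of p w] N_loop'[of w w] N_loop[of "[a]" "[a]"]
      by (simp_all add: rstn)
    note [simp] = N[THEN N_words]
    let ?A = "w @ word_inv w" and ?B = "p @ t @ word_inv p"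
    \<comment> \<open>The absorbed words \<open>?A\<close>, \<open>?B\<close>, \<open>?A\<close> are
      inserted after \<open>?e\<close>; their product is w r t s w^-1.\<close>
    have e: "c ?e = c (?e @ w @ r @ t @ s @ word_inv w)"
    proof -
      have "c ?e = c (?e @ ?A)" using IH by simp
      also have "\<dots> = c (?e @ ?B @ ?A)"
        using ctxt[of ?e "?e @ ?B" "[]" ?A] p(3) by (simp add: rstn(3))
      also have "\<dots> = c (?e @ ?A @ ?B @ ?A)"
        using ctxt[of ?e "?e @ ?A" "[]" "?B @ ?A"] IH by simp
      finally show ?thesis by (simp add: rstn)
    qed
    \<comment> \<open>Multiplying the expansion \<open>e\<close> by w t w^-1 adds a second
      \<open>t\<close>. Commuting it past \<open>s\<close> and \<open>n\<close> merges it with the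
      first, so the factor w t w^-1 is absorbed.\<close>
    have "c (?e @ w @ t @ word_inv w) = c (?e @ w @ r @ t @ s @ n @ t @ word_inv w)"
      using ctxt[of ?e "?e @ w @ r @ t @ s @ word_inv w" "[]" "w @ t @ word_inv w"] e
      by (simp add: rstn(4))
    also have "\<dots> = c (?e @ w @ r @ t @ t @ s @ n @ word_inv w)"
      using ctxt[of "(s @ n) @ t" "t @ (s @ n)" "?e @ w @ r @ t" "word_inv w"]
        N_comm[of "s @ n" t] N N_append by simp
    also have "\<dots> = c (?e @ w @ r @ t @ s @ n @ word_inv w)"
      using ctxt[of "t @ t" t "?e @ w @ r" "s @ n @ word_inv w"] idem_c N by simp
    also have "\<dots> = c (?e @ w @ r @ t @ s @ word_inv w)"
      using ctxt[of "n @ word_inv w" "word_inv w" "?e @ w @ r @ t @ s" "[]"]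
        reg_c[of "word_inv w"] by (simp add: rstn(4))
    finally show ?case using e by (simp add: rstn(3))
  qed
  note [simp] = uv(1,2)
  have val: "val u = val v" and edges: "walk_edges \<one> u = walk_edges \<one> v"
    using uv(3) by (simp_all add: MM_word_def word_graph_conv)
  \<comment> \<open>Equal graphs absorb each other, and u u^-1 commutes with v v^-1, so the two
    idempotents coincide.\<close>
  have ee: "c (u @ word_inv u) = c (v @ word_inv v)"
    using absorb[of u v] absorb[of v u] comm_c[of u v] edges by simp
  \<comment> \<open>\<open>a\<close> and \<open>b\<close> measure the difference of the two words:
    modulo \<open>k\<close>, u = va and v = ub. Also ua = u because \<open>a\<close> is idempotent,
    so u = uba = uab = ub = v.\<close>
  define a b where ab: "a = word_inv v @ u" "b = word_inv u @ v"
  have N: "N a" "N b" using N_loop'[of v u] N_loop'[of u v] val by (simp_all add: ab)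
  note [simp] = N[THEN N_words]
  have u: "c u = c (v @ a)"
    using ctxt[of "u @ word_inv u" "v @ word_inv v" "[]" u] ee reg_c[of u] by (simp add: ab)
  have v: "c v = c (u @ b)"
    using ctxt[of "u @ word_inv u" "v @ word_inv v" "[]" v] ee reg_c[of v] by (simp add: ab)
  have ua: "c (u @ a) = c u"
    using ctxt[of u "v @ a" "[]" a] ctxt[of "a @ a" a v "[]"] idem_c[of a] N u by simp
  have "c u = c (u @ b @ a)" using u v ctxt[of v "u @ b" "[]" a] by simp
  also have "\<dots> = c (u @ a @ b)" using ctxt[of "b @ a" "a @ b" u "[]"] N_comm[of b a] N by simp
  also have "\<dots> = c v" using ctxt[of "u @ a" u "[]" b] ua v by simp
  finally show ?thesis by (simp add: c_iff)
qed


section \<open>The two congruences\<close>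

lemma path_span_path: "path_span G f \<one> (path \<one> w) = word_graph G f w"
  by (simp add: word_graph_def)

lemma simple_cay_path_iff:
  "simple_cay_path X G f \<one> p g \<longleftrightarrow>
    (\<exists>w\<in>words X. p = path \<one> w \<and> val w = g \<and> distinct (walk_vertices \<one> w))"
proof
  assume "simple_cay_path X G f \<one> p g"
  then have "path_label p \<in> words X" "p = path \<one> (path_label p)" "val (path_label p) = g"
      "distinct (walk_vertices \<one> (path_label p))"
    by (auto simp: simple_cay_path_def cay_path_iff walk_vertices_def)
  then show "\<exists>w\<in>words X. p = path \<one> w \<and> val w = g \<and> distinct (walk_vertices \<one> w)" by blast
next
  assume "\<exists>w\<in>words X. p = path \<one> w \<and> val w = g \<and> distinct (walk_vertices \<one> w)"
  then show "simple_cay_path X G f \<one> p g"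
    by (auto simp: simple_cay_path_def walk_vertices_def cay_path_iff)
qed

lemma xi_cong_conv:
  "xi_cong X G f = cong_gen (MM X G f) {(MM_word G f u, MM_word G f v) |u v.
     u \<in> words X \<and> v \<in> words X \<and> val u = val v \<and>
     distinct (walk_vertices \<one> u) \<and> distinct (walk_vertices \<one> v)}"
  unfolding xi_cong_def
proof (rule arg_cong[where f = "cong_gen (MM X G f)"], intro equalityI subsetI;
    elim CollectE exE conjE)
  fix z p q g
  assume z: "z = ((path_span G f \<one> p, g), (path_span G f \<one> q, g))"
    and "simple_cay_path X G f \<one> p g" "simple_cay_path X G f \<one> q g"
  then obtain u v where "u \<in> words X" "v \<in> words X" "p = path \<one> u" "q = path \<one> v"
      "val u = g" "val v = g" "distinct (walk_vertices \<one> u)" "distinct (walk_vertices \<one> v)"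
    unfolding simple_cay_path_iff by blast
  then show "z \<in> {(MM_word G f u, MM_word G f v) |u v.
     u \<in> words X \<and> v \<in> words X \<and> val u = val v \<and>
     distinct (walk_vertices \<one> u) \<and> distinct (walk_vertices \<one> v)}"
    by (intro CollectI exI[of _ u] exI[of _ v]) (simp add: z MM_word_def path_span_path)
next
  fix z u v
  assume "z = (MM_word G f u, MM_word G f v)" "u \<in> words X" "v \<in> words X" "val u = val v"
    "distinct (walk_vertices \<one> u)" "distinct (walk_vertices \<one> v)"
  then show "z \<in> {((path_span G f \<one> p, g), (path_span G f \<one> q, g)) |p q g.
     g \<in> carrier G \<and> simple_cay_path X G f \<one> p g \<and> simple_cay_path X G f \<one> q g}"
    unfolding simple_cay_path_iff
    by (intro CollectI exI[of _ "path \<one> u"] exI[of _ "path \<one> v"] exI[of _ "val v"])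
      (auto simp: MM_word_def path_span_path)
qed

lemma congruence_xi: "congruence (MM X G f) (xi_cong X G f)"
  unfolding xi_cong_conv by (rule congruence_cong_gen[OF monoid_MM]) (auto simp: MM_word_closed)

lemma congruence_theta: "congruence (MM X G f) (theta_cong X G f)"
  unfolding theta_cong_def
  by (rule congruence_cong_gen[OF monoid_MM]) (auto simp: MM_word_closed theta_def)

text \<open>A simple cycle may be based anywhere; translating it to the identity leaves a condition
  on the word alone.\<close>

lemma cyclic_word_iff:
  "cyclic_word X G f w \<longleftrightarrow> cyclically_reduced w \<and> w \<in> words X \<and> val w = \<one> \<and>
    distinct (butlast (walk_vertices \<one> w))"
proof
  assume "cyclic_word X G f w"
  then obtain g p where "cyclically_reduced w" "cay_path X G f g p g" "distinct (map fst p)"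
      "path_label p = w"
    by (auto simp: cyclic_word_def simple_cay_cycle_def)
  moreover have w: "g \<in> carrier G" "w \<in> words X" "p = path g w" "g = g \<otimes> val w"
    using calculation by (simp_all add: cay_path_iff)
  moreover have "g \<otimes> val w = g \<otimes> \<one>" using w by simp
  then have "val w = \<one>" using w(1,2) by (simp del: r_one)
  ultimately show "cyclically_reduced w \<and> w \<in> words X \<and> val w = \<one> \<and>
      distinct (butlast (walk_vertices \<one> w))"
    using distinct_walk_vertices(2)[of g w] by (simp add: map_fst_path)
next
  assume "cyclically_reduced w \<and> w \<in> words X \<and> val w = \<one> \<and>
      distinct (butlast (walk_vertices \<one> w))"
  then show "cyclic_word X G f w"
    using cay_path_path[of \<one> w]
    by (auto simp: cyclic_word_def simple_cay_cycle_def map_fst_path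
        intro!: exI[of _ \<one>] exI[of _ "path \<one> w"])
qed

text \<open>Both pieces are nonempty, so the end of each is the start of the other and, by
  simplicity of the cycle, differs from its own earlier vertices. The second piece is read backwards
  to share the endpoints of the first.\<close>

lemma theta_in_xi:
  assumes "(u, v) \<in> theta X G f"
  shows "(MM_word G f u, MM_word G f (word_inv v)) \<in> xi_cong X G f"
proof -
  have uv [simp]: "u \<in> words X" "v \<in> words X" and "u \<noteq> []" "v \<noteq> []" and one: "val u \<otimes> val v = \<one>"
    and dist: "distinct (butlast (walk_vertices \<one> u) @ butlast (walk_vertices (val u) v))"
    using assms by (auto simp: theta_def cyclic_word_iff walk_vertices_append butlast_append)
  obtain a v' where v: "v = a # v'" using \<open>v \<noteq> []\<close> by (cases v) auto
  obtain b u' where u: "u = b # u'" using \<open>u \<noteq> []\<close> by (cases u) auto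
  have "walk_vertices \<one> u = butlast (walk_vertices \<one> u) @ [val u]"
    using append_butlast_last_id[of "walk_vertices \<one> u"] by (simp add: last_walk_vertices)
  moreover have "val u \<in> set (butlast (walk_vertices (val u) v))" by (simp add: v)
  ultimately have du: "distinct (walk_vertices \<one> u)"
    using dist by (metis disjoint_iff distinct.simps(2) distinct1_rotate distinct_append
        empty_set rotate1.simps(2))
  have "walk_vertices (val u) v = butlast (walk_vertices (val u) v) @ [\<one>]"
    using append_butlast_last_id[of "walk_vertices (val u) v"] one by (simp add: last_walk_vertices)
  moreover have "\<one> \<in> set (butlast (walk_vertices \<one> u))" by (simp add: u)
  ultimately have "distinct (walk_vertices (val u) v)"
    using dist by (metis disjoint_iff distinct.simps(2) distinct1_rotate distinct_append
        empty_set rotate1.simps(2))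
  then have "distinct (walk_vertices \<one> (word_inv v))"
    using walk_vertices_word_inv[of "val u" v] one by simp
  moreover have "val u = val (word_inv v)"
    using one inv_equality[of "val u" "val v"] by simp
  ultimately show ?thesis
    unfolding xi_cong_conv using du uv
    by (intro subsetD[OF cong_gen_incl] CollectI exI[of _ u] exI[of _ "word_inv v"]) simp
qed

section \<open>Cutting simple walks and simple cycles\<close>

lemma in_butlast_walk_vertices_iff:
  "g \<in> carrier G \<Longrightarrow> w \<in> words X \<Longrightarrow>
    h \<in> set (butlast (walk_vertices g w)) \<longleftrightarrow> (\<exists>p b q. w = p @ b # q \<and> h = g \<otimes> val p)"
  by (simp only: map_fst_path[symmetric] set_map image_iff Bex_def split_paired_Ex in_path_iff) auto

lemma start_in_walk_vertices:
  "g \<in> set (walk_vertices g w)" "w \<noteq> [] \<Longrightarrow> g \<in> set (butlast (walk_vertices g w))"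
  by (cases w; simp)+

text \<open>A cancelling pair, inside the word or across its ends, would produce a proper nonempty
  closed factor and so a repeated vertex, unless the word is the pair itself. Length two is
  therefore treated by its own hypothesis.\<close>

lemma cyclically_reduced_simple_cycle:
  assumes w: "w \<in> words X" "val w = \<one>" "distinct (butlast (walk_vertices \<one> w))"
    and len: "length w \<ge> 2" "length w = 2 \<Longrightarrow> w ! 1 \<noteq> letter_inv (w ! 0)"
  shows "cyclically_reduced w"
proof -
  \<comment> \<open>With \<open>t\<close> nonempty, \<open>val s\<close> starts both an edge of
    \<open>m\<close> and an edge of \<open>t\<close>. For empty \<open>t\<close> the return would be
    the closing vertex of the cycle, which is not counted.\<close>
  have no_loop: False if "w = s @ m @ t" "val m = \<one>" "m \<noteq> []" "t \<noteq> []" for s m t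
  proof -
    have [simp]: "s \<in> words X" "m \<in> words X" "t \<in> words X" using w(1) that(1) by auto
    have "butlast (walk_vertices \<one> w) = butlast (walk_vertices \<one> s) @
        butlast (walk_vertices (val s) m) @ butlast (walk_vertices (val s) t)"
      using that(2) by (simp add: that(1) walk_vertices_append butlast_append)
    then show False
      using w(3) start_in_walk_vertices(2)[of m "val s"] start_in_walk_vertices(2)[of t "val s"] that
      by auto
  qed
  have "reduced w"
    unfolding reduced_def
  proof (rule notI, elim exE)
    fix p a q assume pq: "w = p @ [a, letter_inv a] @ q"
    have [simp]: "p \<in> words X" "a \<in> letters X" "q \<in> words X" using w(1) pq by auto
    have [simp]: "q = []" using no_loop[of p "[a, letter_inv a]" q] pq by (cases q) auto
    \<comment> \<open>Now the pair ends the word. The rest \<open>p\<close> is closed as well, and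
      the pair serves as the nonempty tail.\<close>
    have "val p = \<one>" using w(2) pq by simp
    then have "p = []" using no_loop[of "[]" p "[a, letter_inv a]"] pq by (cases p) auto
    then show False using len(2) pq by simp
  qed
  moreover have "last w \<noteq> letter_inv (hd w)"
  proof
    assume last: "last w = letter_inv (hd w)"
    obtain a w' where "w = a # w'" using len(1) by (cases w) auto
    moreover have "w' \<noteq> []" using len(1) calculation by auto
    ultimately have "w = a # butlast w' @ [letter_inv a]"
      using last append_butlast_last_id[of w'] by simp
    then obtain m where m: "w = a # m @ [letter_inv a]" by blast
    have [simp]: "m \<in> words X" "a \<in> letters X" using w(1) m by auto
    have "lval a \<otimes> val m \<otimes> inv lval a = \<one>" using w(2) m by (simp add: m_assoc)
    then have "lval a \<otimes> val m = lval a" by (simp add: inv_solve_right')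
    then have "val m = \<one>" by simp
    then have "m = []" using no_loop[of "[a]" m "[letter_inv a]"] m by auto
    then show False using len(2) m by simp
  qed
  ultimately show ?thesis by (simp add: cyclically_reduced_def)
qed

lemma simple_walk_infix:
  assumes "distinct (walk_vertices \<one> (s @ m @ t))" "s @ m @ t \<in> words X" "val m = \<one>"
  shows "m = []"
proof (rule ccontr)
  assume "m \<noteq> []"
  have "walk_vertices \<one> (s @ m @ t) = butlast (walk_vertices \<one> s) @
      butlast (walk_vertices (val s) m) @ walk_vertices (val s) t"
    using assms by (simp add: walk_vertices_append)
  then show False
    using assms(1) start_in_walk_vertices(2)[of m "val s"] start_in_walk_vertices(1)[of "val s" t]
      \<open>m \<noteq> []\<close> by auto
qed

lemma simple_walk_appendD:
  assumes "distinct (walk_vertices \<one> (s @ t))" "s \<in> words X" "t \<in> words X"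
  shows "distinct (walk_vertices \<one> s)" "distinct (walk_vertices \<one> t)"
proof -
  have *: "distinct (butlast (walk_vertices \<one> s) @ walk_vertices (val s) t)"
    using assms by (simp add: walk_vertices_append)
  then show "distinct (walk_vertices \<one> t)"
    using distinct_walk_vertices(1)[of "val s" t] assms by simp
  have "walk_vertices \<one> s = butlast (walk_vertices \<one> s) @ [val s]"
    using append_butlast_last_id[of "walk_vertices \<one> s"] assms by (simp add: last_walk_vertices)
  moreover have "distinct (butlast (walk_vertices \<one> s) @ [val s])"
    using * start_in_walk_vertices(1)[of "val s" t] by auto
  ultimately show "distinct (walk_vertices \<one> s)" by simp
qed

text \<open>Cut the first path at its first return to the second one. The two initial pieces bound a
  simple cycle, and the two remaining pieces are again simple and coterminal.\<close>

lemma simple_walks_theta: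
  assumes "u \<in> words X" "v \<in> words X" "val u = val v"
    "distinct (walk_vertices \<one> u)" "distinct (walk_vertices \<one> v)"
  shows "(MM_word G f u, MM_word G f v) \<in> theta_cong X G f"
  using assms
proof (induction "length u" arbitrary: u v rule: less_induct)
  case less
  note [simp] = less.prems(1,2)
  note refl = congruence_refl[OF congruence_theta MM_word_closed]
    and mult = congruence_mult[OF congruence_theta]
  show ?case
  proof (cases "u = [] \<or> v = []")
    case True
    then have "u = []" "v = []"
      using simple_walk_infix[of "[]" u "[]"] simple_walk_infix[of "[]" v "[]"] less.prems by auto
    then show ?thesis using refl by simp
  next
    case False
    then obtain a u' b v' where uv: "u = a # u'" "v = b # v'" by (meson list.exhaust)
    have [simp]: "a \<in> letters X" "u' \<in> words X" "b \<in> letters X" "v' \<in> words X"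
      using less.prems(1,2) uv by auto
    \<comment> \<open>A shared first letter is stripped rather than cut off: cutting there would
      give the cycle a a^-1, which is not reduced.\<close>
    show ?thesis
    proof (cases "a = b")
      case True
      have "(MM_word G f u', MM_word G f v') \<in> theta_cong X G f"
        using less.prems True simple_walk_appendD(2)[of "[a]" u'] simple_walk_appendD(2)[of "[b]" v']
        by (intro less.hyps) (simp_all add: uv)
      from mult[OF refl[of "[a]"] this] show ?thesis
        using True by (simp add: uv MM_word_mult)
    next
      case ab: False
      \<comment> \<open>\<open>n > 0\<close> rules out the common start, and the common end
        guarantees that some \<open>n\<close> qualifies.\<close>
      define P where "P n \<longleftrightarrow> n > 0 \<and> n \<le> length u \<and> val (take n u) \<in> set (walk_vertices \<one> v)" for n
      define n where "n = (LEAST n. P n)"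
      have "val v \<in> set (walk_vertices \<one> v)"
        using less.prems by (auto simp: in_walk_vertices_iff intro: exI[of _ v])
      then have "P (length u)" using False less.prems by (simp add: P_def)
      then have n: "P n" unfolding n_def by (rule LeastI)
      define p\<^sub>1 p\<^sub>2 where "p\<^sub>1 = take n u" "p\<^sub>2 = drop n u"
      then have u: "u = p\<^sub>1 @ p\<^sub>2" and len: "length p\<^sub>1 = n" using n by (auto simp: P_def)
      have [simp]: "p\<^sub>1 \<in> words X" "p\<^sub>2 \<in> words X" using less.prems(1) u by auto
      have "val p\<^sub>1 \<in> set (walk_vertices \<one> v)" using n by (simp add: P_def p\<^sub>1_p\<^sub>2_def)
      then obtain q\<^sub>1 q\<^sub>2 where v: "v = q\<^sub>1 @ q\<^sub>2" and val: "val p\<^sub>1 = \<one> \<otimes> val q\<^sub>1"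
        using less.prems(2) by (auto simp: in_walk_vertices_iff)
      have [simp]: "q\<^sub>1 \<in> words X" "q\<^sub>2 \<in> words X" using less.prems(2) v by auto
      have val: "val p\<^sub>1 = val q\<^sub>1" using val by simp
      have p\<^sub>1: "p\<^sub>1 \<noteq> []" using n len by (auto simp: P_def)
      have q\<^sub>1: "q\<^sub>1 \<noteq> []"
        using simple_walk_infix[of "[]" p\<^sub>1 p\<^sub>2] less.prems p\<^sub>1 val u by auto
      have dp: "distinct (walk_vertices \<one> p\<^sub>1)" "distinct (walk_vertices \<one> p\<^sub>2)"
        and dq: "distinct (walk_vertices \<one> q\<^sub>1)" "distinct (walk_vertices \<one> q\<^sub>2)"
        using less.prems simple_walk_appendD[of p\<^sub>1 p\<^sub>2] simple_walk_appendD[of q\<^sub>1 q\<^sub>2]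
        by (simp_all add: u v)
      \<comment> \<open>A vertex of \<open>p\<^sub>1\<close> before its end that lies on
        \<open>q\<^sub>1\<close> would be an earlier return, unless it is the identity. That case is
        excluded because \<open>tl\<close> removes the start of \<open>q\<^sub>1\<close>, which is
        not revisited.\<close>
      have disj: False
        if x: "x \<in> set (butlast (walk_vertices \<one> p\<^sub>1))" "x \<in> set (tl (walk_vertices \<one> q\<^sub>1))" for x
      proof -
        obtain p c q where p: "p\<^sub>1 = p @ c # q" "x = \<one> \<otimes> val p"
          using x(1) by (auto simp: in_butlast_walk_vertices_iff)
        have [simp]: "p \<in> words X"
          using \<open>p\<^sub>1 \<in> words X\<close> p(1) by simp
        have "p \<noteq> []"
          using dq(1) q\<^sub>1 x(2) p(2) by (cases q\<^sub>1) auto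
        have "x \<in> set (walk_vertices \<one> q\<^sub>1)" using x(2) by (auto dest: list.set_sel(2)[rotated])
        then have "x \<in> set (walk_vertices \<one> v)"
          by (simp add: v in_walk_vertices_iff) (metis append_assoc)
        then have "P (length p)" using p u \<open>p \<noteq> []\<close> by (simp add: P_def)
        then have "n \<le> length p" unfolding n_def by (rule Least_le)
        then show False using p(1) len by simp
      qed
      \<comment> \<open>Out along \<open>p\<^sub>1\<close> and back along \<open>q\<^sub>1\<close>:
        the meeting vertex is counted only in the second list and the identity only in the
        first.\<close>
      have wv: "butlast (walk_vertices \<one> (p\<^sub>1 @ word_inv q\<^sub>1)) =
          butlast (walk_vertices \<one> p\<^sub>1) @ rev (tl (walk_vertices \<one> q\<^sub>1))"
        using walk_vertices_word_inv[of \<one> q\<^sub>1] val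
        by (simp add: walk_vertices_append butlast_append butlast_rev)
      then have dist: "distinct (butlast (walk_vertices \<one> (p\<^sub>1 @ word_inv q\<^sub>1)))"
        using disj dp(1) dq(1) by (auto simp: distinct_butlast distinct_tl)
      have "cyclically_reduced (p\<^sub>1 @ word_inv q\<^sub>1)"
      proof (rule cyclically_reduced_simple_cycle)
        show "length (p\<^sub>1 @ word_inv q\<^sub>1) \<ge> 2"
          using p\<^sub>1 q\<^sub>1 by (cases p\<^sub>1; cases q\<^sub>1) auto
        \<comment> \<open>Both pieces are single edges here, and \<open>a \<noteq> b\<close>
          prevents backtracking.\<close>
        assume "length (p\<^sub>1 @ word_inv q\<^sub>1) = 2"
        then have "p\<^sub>1 = [a]" "q\<^sub>1 = [b]"
          using p\<^sub>1 q\<^sub>1 u v uv by (cases p\<^sub>1; cases q\<^sub>1; force)+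
        then show "(p\<^sub>1 @ word_inv q\<^sub>1) ! 1 \<noteq> letter_inv ((p\<^sub>1 @ word_inv q\<^sub>1) ! 0)"
          using ab letter_inv_letter_inv by (simp, metis)
      qed (use dist val in simp_all)
      then have "(p\<^sub>1, word_inv q\<^sub>1) \<in> theta X G f"
        using p\<^sub>1 q\<^sub>1 dist val by (simp add: theta_def cyclic_word_iff)
      then have "(MM_word G f p\<^sub>1, MM_word G f q\<^sub>1) \<in> theta_cong X G f"
        unfolding theta_cong_def
        by (intro subsetD[OF cong_gen_incl] CollectI exI[of _ p\<^sub>1] exI[of _ "word_inv q\<^sub>1"]) simp
      \<comment> \<open>The tails may be compared as walks from the identity, because the product in
        M(G,X) translates them. The measure drops because \<open>p\<^sub>1\<close> is
        nonempty.\<close>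
      moreover have "(MM_word G f p\<^sub>2, MM_word G f q\<^sub>2) \<in> theta_cong X G f"
        using less.prems(3) p\<^sub>1 dp(2) dq(2) val by (intro less.hyps) (simp_all add: u v)
      ultimately show ?thesis
        using mult by (metis MM_word_mult \<open>p\<^sub>1 \<in> words X\<close> \<open>p\<^sub>2 \<in> words X\<close> \<open>q\<^sub>1 \<in> words X\<close>
            \<open>q\<^sub>2 \<in> words X\<close> u v)
    qed
  qed
qed

lemma xi_eq_theta: "xi_cong X G f = theta_cong X G f"
proof
  show "xi_cong X G f \<subseteq> theta_cong X G f"
    unfolding xi_cong_conv
    by (rule cong_gen_least[OF congruence_theta]) (auto intro: simple_walks_theta)
  show "theta_cong X G f \<subseteq> xi_cong X G f"
    unfolding theta_cong_def
    by (rule cong_gen_least[OF congruence_xi]) (auto intro: theta_in_xi)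
qed


section \<open>The presentation\<close>

definition MsF_word :: "'x word \<Rightarrow> (('g, 'x) graph \<times> 'g) set" where
  "MsF_word w = xi_cong X G f `` {MM_word G f w}"

definition relations :: "('x word \<times> 'x word) set" where
  "relations = {(w @ w, w) |w. w \<in> words X \<and> val w = \<one>} \<union>
     {(u, word_inv v) |u v. u \<in> words X \<and> v \<in> words X \<and> (u, v) \<in> theta X G f}"

lemma MsF_word_hom: "MsF_word \<in> hom (word_monoid X) (MsF X G f)"
  using MM_word_closed
  by (auto simp: hom_def MsF_def MsF_word_def quot_monoid_simps
      quot_monoid_mult[OF congruence_xi] MM_word_mult)

lemma MsF_word_mult:
  "u \<in> words X \<Longrightarrow> v \<in> words X \<Longrightarrow> MsF_word u \<otimes>\<^bsub>MsF X G f\<^esub> MsF_word v = MsF_word (u @ v)"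
  using hom_mult[OF MsF_word_hom] by simp

lemma MsF_word_image: "MsF_word ` words X = carrier (MsF X G f)"
  unfolding MsF_def MsF_word_def quot_monoid_simps MM_word_image[symmetric] image_image ..

lemma MsF_word_eq_iff:
  "u \<in> words X \<Longrightarrow> v \<in> words X \<Longrightarrow>
    MsF_word u = MsF_word v \<longleftrightarrow> (MM_word G f u, MM_word G f v) \<in> xi_cong X G f"
  unfolding MsF_word_def
  by (rule congruence_class_eq_iff[OF congruence_xi]) (auto simp: MM_word_closed)

lemma monoid_MsF: "monoid (MsF X G f)"
  unfolding MsF_def by (rule monoid_quot_monoid[OF monoid_MM congruence_xi])

lemma MsF_word_eqI:
  "u \<in> words X \<Longrightarrow> v \<in> words X \<Longrightarrow> walk_edges \<one> u = walk_edges \<one> v \<Longrightarrow> val u = val v \<Longrightarrow>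
    MsF_word u = MsF_word v"
  using MM_word_eqI[of u v] by (simp add: MsF_word_def)

text \<open>Equality of group components is a congruence containing the generators of \<xi>, so the
  component survives in the quotient. It later shows that idempotents come from words trivial in
  G.\<close>

lemma MsF_word_eqD:
  assumes "u \<in> words X" "v \<in> words X" "MsF_word u = MsF_word v"
  shows "val u = val v"
proof -
  let ?M = "MM X G f"
  have "congruence ?M {(m, n). m \<in> carrier ?M \<and> n \<in> carrier ?M \<and> snd m = snd n}"
    by (rule congruenceI)
      (auto simp: monoid.m_closed[OF monoid_MM], auto simp: MM_def)
  then have "xi_cong X G f \<subseteq> {(m, n). m \<in> carrier ?M \<and> n \<in> carrier ?M \<and> snd m = snd n}"
    unfolding xi_cong_conv by (rule cong_gen_least) (auto simp: MM_word_closed, auto simp: MM_word_def)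
  then show ?thesis using assms by (auto simp: MsF_word_eq_iff MM_word_def)
qed

section \<open>The inverse monoid structure of the quotient\<close>

lemma walk_edges_regular:
  "w \<in> words X \<Longrightarrow> walk_edges \<one> (w @ word_inv w @ w) = walk_edges \<one> w"
  using walk_edges_word_inv[of \<one> w] by (simp add: walk_edges_append)

lemma walk_edges_loops:
  "u \<in> words X \<Longrightarrow> v \<in> words X \<Longrightarrow> val u = \<one> \<Longrightarrow> walk_edges \<one> (u @ v) = walk_edges \<one> u \<union> walk_edges \<one> v"
  by (simp add: walk_edges_append)

lemma MsF_word_regular: "w \<in> words X \<Longrightarrow> MsF_word (w @ word_inv w @ w) = MsF_word w"
  by (rule MsF_word_eqI) (simp_all only: walk_edges_regular, simp_all)

text \<open>A word trivial in G contributes its edges without moving the base point, so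
  concatenation becomes a union of graphs.\<close>

lemma MsF_word_comm:
  assumes "u \<in> words X" "v \<in> words X" "val u = \<one>" "val v = \<one>"
  shows "MsF_word (u @ v) = MsF_word (v @ u)"
  using assms by (intro MsF_word_eqI) (auto simp: walk_edges_loops)

lemma gen_inverse_MsF_word:
  "w \<in> words X \<Longrightarrow> gen_inverse (MsF X G f) (MsF_word w) (MsF_word (word_inv w))"
  using MsF_word_regular[of w] MsF_word_regular[of "word_inv w"] MsF_word_image
  by (auto simp: gen_inverse_def MsF_word_mult)

lemma inverse_monoid_MsF: "inverse_monoid (MsF X G f)"
proof (rule inverse_monoidI[OF monoid_MsF])
  show "\<exists>b. gen_inverse (MsF X G f) a b" if "a \<in> carrier (MsF X G f)" for a
    using that gen_inverse_MsF_word unfolding MsF_word_image[symmetric] by auto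
next
  fix a b assume "a \<in> carrier (MsF X G f)" "b \<in> carrier (MsF X G f)"
    and idem: "a \<otimes>\<^bsub>MsF X G f\<^esub> a = a" "b \<otimes>\<^bsub>MsF X G f\<^esub> b = b"
  then obtain u v where uv: "u \<in> words X" "v \<in> words X" "a = MsF_word u" "b = MsF_word v"
    unfolding MsF_word_image[symmetric] by auto
  then have "val u = \<one>" "val v = \<one>"
    using idem MsF_word_eqD[of "u @ u" u] MsF_word_eqD[of "v @ v" v] by (simp_all add: MsF_word_mult)
  then show "a \<otimes>\<^bsub>MsF X G f\<^esub> b = b \<otimes>\<^bsub>MsF X G f\<^esub> a"
    using MsF_word_comm uv by (simp add: MsF_word_mult)
qed

lemma MsF_gen_conv: "MsF_gen X G f x = MsF_word [(x, True)]"
  by (simp add: MsF_gen_def MsF_word_def)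

lemma generated_MsF: "generated_inverse_monoid X (MsF X G f) (MsF_gen X G f)"
  unfolding generated_inverse_monoid_def
proof (intro conjI allI impI)
  show "inverse_monoid (MsF X G f)" by (rule inverse_monoid_MsF)
  have x: "[(x, b)] \<in> words X" if "x \<in> X" for x b using that by (simp add: letters_def)
  show "MsF_gen X G f \<in> X \<rightarrow> carrier (MsF X G f)"
    using x by (auto simp: MsF_gen_conv MsF_word_image[symmetric])
  fix T assume T: "submonoid T (MsF X G f) \<and>
    (\<forall>a\<in>T. \<forall>b. gen_inverse (MsF X G f) a b \<longrightarrow> b \<in> T) \<and> MsF_gen X G f ` X \<subseteq> T"
  have letter: "MsF_word [a] \<in> T" if "a \<in> letters X" for a
  proof -
    obtain y b where a: "a = (y, b)" by (cases a)
    then have y: "y \<in> X" using that by (simp add: letters_def)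
    then have T1: "MsF_word [(y, True)] \<in> T" using T by (auto simp: MsF_gen_conv)
    \<comment> \<open>The letters x^-1 are not among the given generators; closure of
      \<open>T\<close> under inverses supplies them.\<close>
    moreover have "MsF_word [(y, False)] \<in> T"
      using T T1 gen_inverse_MsF_word[OF x[OF y, of True]] by (auto simp: letter_inv_def)
    ultimately show ?thesis by (cases b) (simp_all add: a)
  qed
  have "MsF_word w \<in> T" if "w \<in> words X" for w
    using that
  proof (induction w)
    case Nil
    have "MsF_word [] = \<one>\<^bsub>MsF X G f\<^esub>"
      by (simp add: MsF_def MsF_word_def quot_monoid_simps MM_one)
    then show ?case using T submonoid.one_closed by metis
  next
    case (Cons a w)
    then have "MsF_word [a] \<otimes>\<^bsub>MsF X G f\<^esub> MsF_word w \<in> T"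
      using T letter submonoid.m_closed[of T "MsF X G f"] by simp
    then show ?case using Cons.prems by (simp add: MsF_word_mult)
  qed
  then show "T = carrier (MsF X G f)"
    using T submonoid.subset[of T "MsF X G f"] by (auto simp: MsF_word_image[symmetric])
qed

text \<open>By \<open>cong_gen_pullback\<close>, each inclusion of kernels is tested on generators
  once words equal in the intermediate quotient are known to be related. For the free inverse monoid
  this is the Vagner congruence; for M(G,X) it is \<open>MM_word_kernel\<close>.\<close>

lemma presented_MsF: "presented_by X (MsF X G f) (MsF_gen X G f) relations"
proof -
  define \<rho> where "\<rho> = fim_relations_cong X relations"
  define \<phi> where "\<phi> w = \<rho> `` {fim_class X w}" for w
  let ?W = "word_monoid X"
  have relations: "relations \<subseteq> words X \<times> words X" by (auto simp: relations_def)
  then have \<rho>: "congruence (FIM X) \<rho>"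
    unfolding \<rho>_def by (rule congruence_fim_relations_cong)
  have fim: "fim_class X w \<in> carrier (FIM X)" if "w \<in> words X" for w
    using that fim_class_image by blast
  have \<phi>_iff: "\<phi> u = \<phi> v \<longleftrightarrow> (fim_class X u, fim_class X v) \<in> \<rho>"
    if "u \<in> words X" "v \<in> words X" for u v
    unfolding \<phi>_def using that fim by (intro congruence_class_eq_iff[OF \<rho>]) auto
  have \<phi>_hom: "\<phi> \<in> hom ?W (quot_monoid (FIM X) \<rho>)"
    using fim hom_mult[OF fim_class_hom, of _ X]
    by (auto simp: hom_def \<phi>_def quot_monoid_simps quot_monoid_mult[OF \<rho>])
  have \<phi>_image: "\<phi> ` words X = carrier (quot_monoid (FIM X) \<rho>)"
    unfolding \<phi>_def quot_monoid_simps fim_class_image[symmetric] image_image ..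
  \<comment> \<open>\<open>K\<close> is the kernel on words of the map onto M_sF; \<open>L\<close>
    below is that of the map onto the presented monoid.\<close>
  define K where "K = {(u, v). u \<in> carrier ?W \<and> v \<in> carrier ?W \<and>
    (MM_word G f u, MM_word G f v) \<in> xi_cong X G f}"
  have K: "congruence ?W K"
    unfolding K_def by (rule congruence_vimage[OF monoid_word_monoid MM_word_hom congruence_xi])
  have K_iff: "(u, v) \<in> K \<longleftrightarrow> MsF_word u = MsF_word v" if "u \<in> words X" "v \<in> words X" for u v
    using that by (simp add: K_def MsF_word_eq_iff)
  define L where "L = {(u, v). u \<in> carrier ?W \<and> v \<in> carrier ?W \<and>
    (fim_class X u, fim_class X v) \<in> \<rho>}"
  have L: "congruence ?W L"
    unfolding L_def by (rule congruence_vimage[OF monoid_word_monoid fim_class_hom \<rho>])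
  have vagner_L: "vagner X \<subseteq> L"
  proof
    fix z assume z: "z \<in> vagner X"
    obtain u v where uv: "z = (u, v)" by (cases z)
    then have "u \<in> words X" "v \<in> words X"
      using congruence_carrier[OF congruence_vagner] z by (metis word_monoid_simps(1))+
    moreover have "fim_class X u = fim_class X v"
      using calculation z uv by (simp add: fim_class_eq_iff)
    ultimately show "z \<in> L" using congruence_refl[OF \<rho>] fim by (simp add: L_def uv)
  qed
  have rel_L: "(u, v) \<in> L" if "(u, v) \<in> relations" for u v
  proof -
    have "(fim_class X u, fim_class X v) \<in> \<rho>"
      unfolding \<rho>_def fim_relations_cong_def using that by (intro subsetD[OF cong_gen_incl]) auto
    then show ?thesis using that relations by (auto simp: L_def)
  qed
  have vagner_K: "vagner X \<subseteq> K"
    unfolding vagner_def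
  proof (rule cong_gen_least[OF K], rule Un_least; rule subsetI, elim CollectE exE conjE)
    fix z u assume "z = (u @ word_inv u @ u, u)" "u \<in> words X"
    then show "z \<in> K" by (simp add: K_iff MsF_word_regular)
  next
    fix z u v
    assume "z = (u @ word_inv u @ v @ word_inv v, v @ word_inv v @ u @ word_inv u)"
      "u \<in> words X" "v \<in> words X"
    then show "z \<in> K"
      using MsF_word_comm[of "u @ word_inv u" "v @ word_inv v"] by (simp add: K_iff)
  qed
  have rel_K: "(u, v) \<in> K" if rel: "(u, v) \<in> relations" for u v
  proof -
    consider "v \<in> words X" "u = v @ v" "val v = \<one>"
      | w where "w \<in> words X" "u \<in> words X" "v = word_inv w" "(u, w) \<in> theta X G f"
      using rel unfolding relations_def by blast
    then show ?thesis
    proof cases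
      case 1
      then have "MsF_word u = MsF_word v" by (intro MsF_word_eqI) (auto simp: walk_edges_loops)
      then show ?thesis using 1 by (simp add: K_iff)
    qed (simp add: K_def theta_in_xi)
  qed
  have vagnerI: "(w @ word_inv w @ w, w) \<in> vagner X"
    "(w @ word_inv w @ z @ word_inv z, z @ word_inv z @ w @ word_inv w) \<in> vagner X"
    if "w \<in> words X" "z \<in> words X" for w z
    unfolding vagner_def using that by (intro subsetD[OF cong_gen_incl]; blast)+
  have "(u, v) \<in> K" if "u \<in> words X" "v \<in> words X" "(fim_class X u, fim_class X v) \<in> \<rho>" for u v
  proof (rule cong_gen_pullback[OF fim_class_hom _ K])
    show "fim_class X ` carrier ?W = carrier (FIM X)" using fim_class_image by simp
    show "(a, b) \<in> K" if "a \<in> carrier ?W" "b \<in> carrier ?W" "fim_class X a = fim_class X b" for a b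
      using that vagner_K by (auto simp: fim_class_eq_iff)
    show "{(fim_class X u, fim_class X v) |u v. (u, v) \<in> relations}
        \<subseteq> {(fim_class X a, fim_class X b) |a b. (a, b) \<in> K}"
      using rel_K by blast
  qed (use that in \<open>simp_all add: \<rho>_def fim_relations_cong_def\<close>)
  moreover have "(u, v) \<in> L"
    if "u \<in> words X" "v \<in> words X" "(MM_word G f u, MM_word G f v) \<in> xi_cong X G f" for u v
  proof (rule cong_gen_pullback[OF MM_word_hom _ L])
    show "MM_word G f ` carrier ?W = carrier (MM X G f)" using MM_word_image by simp
    \<comment> \<open>The Vagner pairs supply regularity and commutation, relations (i) the
      idempotency.\<close>
    show "(a, b) \<in> L"
      if "a \<in> carrier ?W" "b \<in> carrier ?W" "MM_word G f a = MM_word G f b" for a b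
    proof (rule MM_word_kernel[OF L])
      show "(w @ w, w) \<in> L" if "w \<in> words X" "val w = \<one>" for w
        using that by (intro rel_L) (auto simp: relations_def)
    qed (use that vagnerI vagner_L in auto)
    \<comment> \<open>\<open>xi_eq_theta\<close> makes the generators those of \<theta>, which are
      the images of relations (ii).\<close>
    show "{(MM_word G f u, MM_word G f (word_inv v)) |u v. (u, v) \<in> theta X G f}
        \<subseteq> {(MM_word G f a, MM_word G f b) |a b. (a, b) \<in> L}"
    proof (rule subsetI, elim CollectE exE conjE)
      fix z u v assume z: "z = (MM_word G f u, MM_word G f (word_inv v))" "(u, v) \<in> theta X G f"
      then have "(u, word_inv v) \<in> L" by (intro rel_L) (auto simp: relations_def theta_def)
      then show "z \<in> {(MM_word G f a, MM_word G f b) |a b. (a, b) \<in> L}" using z by blast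
    qed
  qed (use that in \<open>simp_all add: xi_eq_theta theta_cong_def\<close>)
  ultimately have "\<phi> u = \<phi> v \<longleftrightarrow> MsF_word u = MsF_word v"
    if "u \<in> words X" "v \<in> words X" for u v
    using that by (auto simp: \<phi>_iff MsF_word_eq_iff K_def L_def)
  then obtain h where h: "h \<in> iso (quot_monoid (FIM X) \<rho>) (MsF X G f)"
      "\<forall>w\<in>words X. h (\<phi> w) = MsF_word w"
    using iso_of_same_kernel[OF \<phi>_hom _ MsF_word_hom _ monoid_word_monoid] \<phi>_image MsF_word_image
    by auto
  have "h (\<rho> `` {fim_class X [(x, True)]}) = MsF_gen X G f x" if "x \<in> X" for x
    using h(2) that by (simp add: MsF_gen_conv \<phi>_def letters_def)
  then show ?thesis
    unfolding presented_by_def using generated_MsF h(1) by (auto simp: \<rho>_def)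
qed

end

theorem theorem3p3:
  fixes X :: "'x set" and G :: "('g, 'm) monoid_scheme" and f :: "'x \<Rightarrow> 'g"
  assumes "generated_group X G f"
  shows "xi_cong X G f = theta_cong X G f \<and>
    presented_by X (MsF X G f) (MsF_gen X G f)
      ({(w @ w, w) |w. w \<in> words X \<and> word_val G f w = \<one>\<^bsub>G\<^esub>} \<union>
       {(u, word_inv v) |u v. u \<in> words X \<and> v \<in> words X \<and> (u, v) \<in> theta X G f})"
proof -
  interpret cayley X G f
    using assms by (simp add: generated_group_def cayley_def cayley_axioms_def)
  show ?thesis using xi_eq_theta presented_MsF by (simp add: relations_def)
qed

end
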